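(* Let $\mathbb{F}$ be a topological subfield of $\mathbb{R}$ and let $n$ be an odd positive integer. Then $\mathrm{PGL}(n,\mathbb{F})$ is totally minimal.
   Context: A topological subfield of $\mathbb{R}$ carries the inherited topology. $\mathrm{GL}(n,\mathbb{F})$ is the group of invertible $n\times n$ matrices with the pointwise topology inherited from $\mathbb{F}^{n^2}$, and $\mathrm{PGL}(n,\mathbb{F})=\mathrm{GL}(n,\mathbb{F})/Z(\mathrm{GL}(n,\mathbb{F}))$, where $Z$ denotes the center, with the quotient topology. All topological groups are Hausdorff. A topological group is minimal if it admits no strictly coarser Hausdorff group topology; $G$ is totally minimal if every Hausdorff quotient group $G/N$ ($N$ a closed normal subgroup) is minimal. *)

theory Defs
  imports "HOL-Analysis.Analysis" "HOL-Algebra.Algebra" "HOL-Algebra.Algebraic_Closure_Type"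
begin

section \<open>Topological groups and minimality\<close>

definition hausdorff_topological_group ::
    "('a, 'b) monoid_scheme \<Rightarrow> 'a topology \<Rightarrow> bool" where
  "hausdorff_topological_group G T \<longleftrightarrow>
     group G \<and> topspace T = carrier G \<and>
     continuous_map (prod_topology T T) T (\<lambda>(x, y). x \<otimes>\<^bsub>G\<^esub> y) \<and>
     continuous_map T T (\<lambda>x. inv\<^bsub>G\<^esub> x) \<and>
     Hausdorff_space T"

definition coarser_topology :: "'a topology \<Rightarrow> 'a topology \<Rightarrow> bool" where
  "coarser_topology S T \<longleftrightarrow> topspace S = topspace T \<and> (\<forall>U. openin S U \<longrightarrow> openin T U)"

definition minimal_topological_group ::
    "('a, 'b) monoid_scheme \<Rightarrow> 'a topology \<Rightarrow> bool" where
  "minimal_topological_group G T \<longleftrightarrow>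
     hausdorff_topological_group G T \<and>
     \<not> (\<exists>S. hausdorff_topological_group G S \<and> coarser_topology S T \<and> S \<noteq> T)"

definition quotient_group_topology ::
    "('a, 'b) monoid_scheme \<Rightarrow> 'a topology \<Rightarrow> 'a set \<Rightarrow> 'a set topology" where
  "quotient_group_topology G T N =
     topology (\<lambda>U. U \<subseteq> carrier (G Mod N) \<and> openin T {x \<in> carrier G. N #>\<^bsub>G\<^esub> x \<in> U})"

lemma openin_quotient_group_topology:
  "openin (quotient_group_topology G T N) U \<longleftrightarrow>
     U \<subseteq> carrier (G Mod N) \<and> openin T {x \<in> carrier G. N #>\<^bsub>G\<^esub> x \<in> U}"
proof -
  have "istopology (\<lambda>U. U \<subseteq> carrier (G Mod N) \<and> openin T {x \<in> carrier G. N #>\<^bsub>G\<^esub> x \<in> U})"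
    unfolding istopology_def
  proof (intro conjI allI impI)
    fix S U
    assume "S \<subseteq> carrier (G Mod N) \<and> openin T {x \<in> carrier G. N #>\<^bsub>G\<^esub> x \<in> S}"
      and "U \<subseteq> carrier (G Mod N) \<and> openin T {x \<in> carrier G. N #>\<^bsub>G\<^esub> x \<in> U}"
    moreover have "{x \<in> carrier G. N #>\<^bsub>G\<^esub> x \<in> S \<inter> U} =
        {x \<in> carrier G. N #>\<^bsub>G\<^esub> x \<in> S} \<inter> {x \<in> carrier G. N #>\<^bsub>G\<^esub> x \<in> U}"
      by auto
    ultimately show "S \<inter> U \<subseteq> carrier (G Mod N)"
      and "openin T {x \<in> carrier G. N #>\<^bsub>G\<^esub> x \<in> S \<inter> U}"
      by auto
  next
    fix K
    assume *: "\<forall>S\<in>K. S \<subseteq> carrier (G Mod N) \<and> openin T {x \<in> carrier G. N #>\<^bsub>G\<^esub> x \<in> S}"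
    then show "\<Union>K \<subseteq> carrier (G Mod N)" by blast
    have "{x \<in> carrier G. N #>\<^bsub>G\<^esub> x \<in> \<Union>K} = (\<Union>S\<in>K. {x \<in> carrier G. N #>\<^bsub>G\<^esub> x \<in> S})"
      by auto
    with * show "openin T {x \<in> carrier G. N #>\<^bsub>G\<^esub> x \<in> \<Union>K}" by auto
  qed
  then show ?thesis
    by (simp add: quotient_group_topology_def topology_inverse')
qed

lemma quotient_map_quotient_group_topology:
  assumes "topspace T = carrier G"
  shows "quotient_map T (quotient_group_topology G T N) (\<lambda>x. N #>\<^bsub>G\<^esub> x)"
proof -
  have carr: "carrier (G Mod N) = (\<lambda>x. N #>\<^bsub>G\<^esub> x) ` carrier G"
    by (auto simp: FactGroup_def RCOSETS_def)
  then have "{x \<in> carrier G. N #>\<^bsub>G\<^esub> x \<in> carrier (G Mod N)} = topspace T"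
    using assms by auto
  then have "openin (quotient_group_topology G T N) (carrier (G Mod N))"
    by (simp add: openin_quotient_group_topology)
  then have "topspace (quotient_group_topology G T N) = carrier (G Mod N)"
    unfolding topspace_def by (auto simp: openin_quotient_group_topology)
  with carr assms show ?thesis
    by (auto simp: quotient_map_def openin_quotient_group_topology)
qed

text \<open>The quotient \<open>G / N\<close> is Hausdorff precisely when \<open>N\<close> is closed.\<close>

definition totally_minimal_topological_group ::
    "('a, 'b) monoid_scheme \<Rightarrow> 'a topology \<Rightarrow> bool" where
  "totally_minimal_topological_group G T \<longleftrightarrow>
     hausdorff_topological_group G T \<and>
     (\<forall>N. N \<lhd> G \<and> closedin T N \<longrightarrow>
        minimal_topological_group (G Mod N) (quotient_group_topology G T N))"


section \<open>The groups GL and PGL over a subfield of the reals\<close>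

definition group_center :: "('a, 'b) monoid_scheme \<Rightarrow> 'a set" where
  "group_center G = {z \<in> carrier G. \<forall>g \<in> carrier G. z \<otimes>\<^bsub>G\<^esub> g = g \<otimes>\<^bsub>G\<^esub> z}"

abbreviation real_ring :: "real ring" where
  "real_ring \<equiv> ring_of_type_algebra"

lemma subfield_real_ring_iff:
  "subfield F real_ring \<longleftrightarrow>
     0 \<in> F \<and> 1 \<in> F \<and> (\<forall>x\<in>F. \<forall>y\<in>F. x + y \<in> F \<and> x * y \<in> F) \<and>
     (\<forall>x\<in>F. - x \<in> F) \<and> (\<forall>x\<in>F. x \<noteq> 0 \<longrightarrow> inverse x \<in> F)"
  (is "_ \<longleftrightarrow> ?R")
proof -
  interpret R: field real_ring by (rule field_from_type_algebra)
  have sel: "carrier real_ring = UNIV" "x \<otimes>\<^bsub>real_ring\<^esub> y = x * y"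
      "\<one>\<^bsub>real_ring\<^esub> = 1" "x \<oplus>\<^bsub>real_ring\<^esub> y = x + y" "\<zero>\<^bsub>real_ring\<^esub> = 0" for x y
    by (simp_all add: ring_of_type_algebra_def)
  have neg: "\<ominus>\<^bsub>real_ring\<^esub> x = - x" for x
    by (rule R.minus_equality) (simp_all add: sel)
  have inv: "inv\<^bsub>real_ring\<^esub> x = inverse x" if "x \<noteq> 0" for x
    by (rule R.comm_inv_char) (use that in \<open>simp_all add: sel\<close>)
  show ?thesis
  proof
    assume F: "subfield F real_ring"
    then have "subring F real_ring" by (rule subfieldE(1))
    moreover have "inverse x \<in> F" if "x \<in> F" "x \<noteq> 0" for x
      using R.subfield_m_inv(1)[OF F, of x] that inv[of x] by (simp add: sel)
    ultimately show ?R
      using subringE(2,3,5,6,7)[of F real_ring] by (simp add: sel neg)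
  next
    assume ?R
    then show "subfield F real_ring"
      by (intro R.subfieldI' R.subringI) (auto simp: sel neg inv)
  qed
qed

definition matrix_monoid :: "real set \<Rightarrow> (real^'n^'n) monoid" where
  "matrix_monoid F = \<lparr>carrier = {A. \<forall>i j. A $ i $ j \<in> F}, mult = (**), one = mat 1\<rparr>"

text \<open>Units of the matrix monoid: the inverse is required to have entries in \<open>F\<close> as well.\<close>

definition GL_group :: "real set \<Rightarrow> (real^'n^'n) monoid" where
  "GL_group F = units_of (matrix_monoid F)"

definition GL_topology :: "real set \<Rightarrow> (real^'n^'n) topology" where
  "GL_topology F = top_of_set (carrier (GL_group F))"

definition PGL_group :: "real set \<Rightarrow> (real^'n^'n) set monoid" where
  "PGL_group F = GL_group F Mod group_center (GL_group F)"

definition PGL_topology :: "real set \<Rightarrow> (real^'n^'n) set topology" where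
  "PGL_topology F =
     quotient_group_topology (GL_group F) (GL_topology F) (group_center (GL_group F))"

end

(*
  A nontrivial closed normal subgroup K of GL(n,R), i.e. one with a nonscalar element, contains all
  transvections. Hence, for n odd, a closed normal subgroup of GL(n,F) that contains the scalars and
  a nonscalar matrix is everything: its closure in GL(n,R) contains all transvections and all scalars,
  and for n odd these generate GL(n,R). So it remains to see that PGL(n,F) itself is minimal.

  Given a coarser Hausdorff group topology, let K be the intersection of the usual closures in GL(n,R)
  of its neighbourhoods of the identity. Then K is closed and normal, and K meets GL(n,F) only in
  scalars because the topology is Hausdorff. As transvections with entry 1 lie in GL(n,F), K consists
  of scalars. If the coarser topology were strictly coarser, there would be elements close to 1 in it
  but not in the usual sense; normalized by scalars they would either accumulate at a nonscalar element
  of K, or be unbounded and then conjugate small transvections to elements accumulating at a nonscalar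
  unipotent element of K.
*)

theory Submission
  imports Defs
begin

no_notation fps_nth (infixl "$" 75)

section \<open>Matrices\<close>

text \<open>Closures are taken over the reals because \<open>F\<close> need not be complete:
  compactness yields limits with real entries only. The way back to \<open>F\<close> is that every
  subfield contains the rationals, which are dense in \<real>, so conjugators, scaling factors and
  small transvections can all be chosen rational.

  Oddness enters through determinants: for n odd every real number has a real n-th root, so every
  invertible diagonal matrix is a scalar times a diagonal matrix of determinant 1, and the latter is
  a product of commutators.

  Size modulo scalars is measured by the products \<open>g $ a $ i * matrix_inv g $ j $ b\<close>.
  They do not change when \<open>g\<close> is scaled, and they are the entries of the conjugate of
  the matrix unit E_ij by \<open>g\<close>. For i \<noteq> j they are visible in conjugates of
  transvections. For i = j they are not, since 1 + t E_ii is not unipotent, and a separate estimate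
  recovers them from the others.\<close>

definition single_mat :: "'n \<Rightarrow> 'n \<Rightarrow> real \<Rightarrow> real^'n^'n" where
  "single_mat p q c = (\<chi> i j. if i = p \<and> j = q then c else 0)"

definition diag_mat :: "('n \<Rightarrow> real) \<Rightarrow> real^'n^'n" where
  "diag_mat f = (\<chi> i j. if i = j then f i else 0)"

definition perm_mat :: "('n \<Rightarrow> 'n) \<Rightarrow> real^'n^'n" where
  "perm_mat \<sigma> = (\<chi> i j. if j = \<sigma> i then 1 else 0)"

lemma single_mat_nth [simp]: "single_mat p q c $ i $ j = (if i = p \<and> j = q then c else 0)"
  by (simp add: single_mat_def)

lemma diag_mat_nth [simp]: "diag_mat f $ i $ j = (if i = j then f i else 0)"
  by (simp add: diag_mat_def)

lemma perm_mat_nth [simp]: "perm_mat \<sigma> $ i $ j = (if j = \<sigma> i then 1 else 0)"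
  by (simp add: perm_mat_def)

lemma mat_nth: "mat c $ i $ j = (if i = j then c else 0)"
  by (simp add: mat_def)

lemma mult_nth: "(A ** B) $ i $ j = (\<Sum>k\<in>UNIV. A $ i $ k * B $ k $ j)"
  by (simp add: matrix_matrix_mult_def)

lemma diag_mult_nth [simp]: "(diag_mat f ** A) $ i $ j = f i * A $ i $ j"
  by (simp add: mult_nth if_distrib [of "\<lambda>x. x * y" for y] cong: if_cong)

lemma mult_diag_nth [simp]: "(A ** diag_mat f) $ i $ j = A $ i $ j * f j"
  by (simp add: mult_nth if_distrib [of "\<lambda>x. y * x" for y] cong: if_cong)

lemma perm_mult_nth [simp]: "(perm_mat \<sigma> ** A) $ i $ j = A $ \<sigma> i $ j"
  by (simp add: mult_nth if_distrib [of "\<lambda>x. x * y" for y] cong: if_cong)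

lemma single_mult_nth [simp]: "(single_mat p q c ** A) $ i $ j = (if i = p then c * A $ q $ j else 0)"
  by (cases "i = p") (simp_all add: mult_nth if_distrib [of "\<lambda>x. x * y" for y] cong: if_cong)

lemma mult_single_nth [simp]: "(A ** single_mat p q c) $ i $ j = (if j = q then A $ i $ p * c else 0)"
  by (cases "j = q") (simp_all add: mult_nth if_distrib [of "\<lambda>x. y * x" for y] cong: if_cong)

lemma matrix_mult_add_left: "(A + B) ** C = A ** C + B ** (C :: real^'n^'m)"
  by (simp add: vec_eq_iff mult_nth distrib_right sum.distrib)

lemma matrix_mult_diff_left: "(A - B) ** C = A ** C - B ** (C :: real^'n^'m)"
  by (simp add: vec_eq_iff mult_nth left_diff_distrib sum_subtractf)

lemma matrix_mult_diff_right: "A ** (B - C) = A ** B - A ** (C :: real^'n^'m)"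
  by (simp add: vec_eq_iff mult_nth right_diff_distrib sum_subtractf)

lemma scaleR_mult_left: "(c *\<^sub>R A) ** B = c *\<^sub>R (A ** (B :: real^'n^'m))"
  by (simp add: vec_eq_iff mult_nth sum_distrib_left mult.assoc)

lemma scaleR_mult_right: "A ** (c *\<^sub>R B) = c *\<^sub>R (A ** (B :: real^'n^'m))"
  by (simp add: vec_eq_iff mult_nth sum_distrib_left mult.left_commute)

lemma mat_eq_scaleR: "mat c ** A = c *\<^sub>R (A :: real^'n^'n)" "A ** mat c = c *\<^sub>R A"
  by (simp_all add: vec_eq_iff mult_nth mat_nth if_distrib [of "\<lambda>x. x * y" for y]
      if_distrib [of "\<lambda>x. y * x" for y] cong: if_cong)

lemmas matrix_ring_simps = matrix_add_ldistrib matrix_mult_add_left matrix_mult_diff_left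
  matrix_mult_diff_right scaleR_mult_left scaleR_mult_right matrix_mul_assoc

section \<open>Inverses of matrices\<close>

lemma matrix_inv_works:
  fixes A :: "real^'n^'n"
  assumes "invertible A"
  shows "A ** matrix_inv A = mat 1" "matrix_inv A ** A = mat 1"
  using someI_ex[of "\<lambda>A'. A ** A' = mat 1 \<and> A' ** A = mat 1"] assms
  unfolding invertible_def matrix_inv_def by auto

lemma matrix_inv_eqI:
  fixes A :: "real^'n^'n"
  assumes "A ** B = mat 1" "B ** A = mat 1"
  shows "matrix_inv A = B"
proof -
  have "invertible A" using assms unfolding invertible_def by blast
  then have "B ** (A ** matrix_inv A) = B" by (simp add: matrix_inv_works)
  then show ?thesis using assms(2) by (simp add: matrix_mul_assoc)
qed

lemma invertible_matrix_inv: "invertible A \<Longrightarrow> invertible (matrix_inv (A :: real^'n^'n))"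
  using matrix_inv_works invertible_def by blast

lemma invertibleI: "A ** B = mat 1 \<Longrightarrow> B ** A = mat 1 \<Longrightarrow> invertible A"
  unfolding invertible_def by blast

lemma matrix_inv_involutive: "invertible A \<Longrightarrow> matrix_inv (matrix_inv A) = (A :: real^'n^'n)"
  by (intro matrix_inv_eqI matrix_inv_works)

lemma matrix_inv_mult_cancel:
  fixes A :: "real^'n^'n"
  assumes "invertible A"
  shows "B ** A ** matrix_inv A = B" "B ** matrix_inv A ** A = B"
    "matrix_inv A ** (A ** B) = B" "A ** (matrix_inv A ** B) = B"
  using assms by (simp_all flip: matrix_mul_assoc add: matrix_inv_works)
    (simp_all add: matrix_mul_assoc matrix_inv_works)

lemma matrix_inv_mult:
  fixes A B :: "real^'n^'n"
  assumes "invertible A" "invertible B"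
  shows "matrix_inv (A ** B) = matrix_inv B ** matrix_inv A"
  by (rule matrix_inv_eqI) (simp_all add: assms matrix_mul_assoc matrix_inv_mult_cancel matrix_inv_works)

lemma matrix_inv_one [simp]: "matrix_inv (mat 1 :: real^'n^'n) = mat 1"
  by (rule matrix_inv_eqI) auto

lemma invertible_one [simp]: "invertible (mat 1 :: real^'n^'n)"
  by (rule invertibleI[of _ "mat 1"]) auto

lemma scalar_inverse:
  fixes A :: "real^'n^'n"
  assumes "c \<noteq> 0" "invertible A"
  shows "invertible (c *\<^sub>R A)" "matrix_inv (c *\<^sub>R A) = inverse c *\<^sub>R matrix_inv A"
proof -
  have *: "(c *\<^sub>R A) ** (inverse c *\<^sub>R matrix_inv A) = mat 1"
    "(inverse c *\<^sub>R matrix_inv A) ** (c *\<^sub>R A) = mat 1"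
    using assms by (simp_all add: scaleR_mult_left scaleR_mult_right matrix_inv_works)
  show "invertible (c *\<^sub>R A)" using * by (rule invertibleI)
  show "matrix_inv (c *\<^sub>R A) = inverse c *\<^sub>R matrix_inv A" using * by (rule matrix_inv_eqI)
qed

lemma square_zero_inverse:
  fixes Y :: "real^'n^'n"
  assumes "Y ** Y = 0"
  shows "invertible (mat 1 + Y)" "matrix_inv (mat 1 + Y) = mat 1 - Y"
proof -
  have *: "(mat 1 + Y) ** (mat 1 - Y) = mat 1" "(mat 1 - Y) ** (mat 1 + Y) = mat 1"
    using assms by (simp_all add: matrix_ring_simps)
  show "invertible (mat 1 + Y)" using * by (rule invertibleI)
  show "matrix_inv (mat 1 + Y) = mat 1 - Y" using * by (rule matrix_inv_eqI)
qed

lemma single_square_zero: "p \<noteq> q \<Longrightarrow> single_mat p q c ** single_mat p q d = 0"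
  by (simp add: vec_eq_iff)

lemmas transvection_inverse = square_zero_inverse[OF single_square_zero]

lemma diag_inverse:
  assumes "\<And>i. f i \<noteq> 0"
  shows "invertible (diag_mat f)" "matrix_inv (diag_mat f) = diag_mat (\<lambda>i. inverse (f i))"
proof -
  have *: "diag_mat f ** diag_mat (\<lambda>i. inverse (f i)) = mat 1"
    "diag_mat (\<lambda>i. inverse (f i)) ** diag_mat f = mat 1"
    using assms by (auto simp: vec_eq_iff mat_nth)
  show "invertible (diag_mat f)" using * by (rule invertibleI)
  show "matrix_inv (diag_mat f) = diag_mat (\<lambda>i. inverse (f i))" using * by (rule matrix_inv_eqI)
qed

text \<open>Column \<open>l\<close> of the inverse solves \<open>A x = e_l\<close>, so Cramer's rule
  applies. The formula serves twice: it makes inversion continuous, and it shows that the inverse of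
  a matrix over a subfield has its entries in that subfield.\<close>

lemma matrix_inv_cramer:
  fixes A :: "real^'n^'n"
  assumes "invertible A"
  shows "matrix_inv A $ k $ l
    = det (\<chi> i j. if j = k then (if i = l then 1 else 0) else A $ i $ j) / det A"
proof -
  have "det A \<noteq> 0" using assms by (simp add: invertible_det_nz)
  moreover have "A *v column l (matrix_inv A) = (\<chi> i. if i = l then 1 else 0)"
    using matrix_inv_works(1)[OF assms]
    by (simp add: vec_eq_iff mult_nth matrix_vector_mult_def column_def mat_nth)
  ultimately have "column l (matrix_inv A)
      = (\<chi> k. det (\<chi> i j. if j = k then (\<chi> i. if i = l then 1 else 0) $ i else A $ i $ j) / det A)"
    by (subst (asm) cramer) auto
  then have "column l (matrix_inv A) $ k
      = det (\<chi> i j. if j = k then (\<chi> i. if i = l then 1 else 0) $ i else A $ i $ j) / det A"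
    by simp
  then show ?thesis by (simp add: column_def cong: if_cong)
qed

section \<open>Continuity of the matrix operations and rational approximation\<close>

lemma tendsto_det [tendsto_intros]:
  fixes A :: "'a \<Rightarrow> real^'n^'n"
  assumes "(A \<longlongrightarrow> B) L"
  shows "((\<lambda>x. det (A x)) \<longlongrightarrow> det B) L"
  unfolding det_def by (intro tendsto_intros assms)

lemma tendsto_matrix_mult [tendsto_intros]:
  fixes A :: "'a \<Rightarrow> real^'n^'m" and B :: "'a \<Rightarrow> real^'k^'n"
  assumes "(A \<longlongrightarrow> A0) L" "(B \<longlongrightarrow> B0) L"
  shows "((\<lambda>x. A x ** B x) \<longlongrightarrow> A0 ** B0) L"
  unfolding matrix_matrix_mult_def by (intro tendsto_intros assms)

lemma open_invertible: "open {A :: real^'n^'n. invertible A}"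
proof -
  have "continuous_on UNIV (det :: real^'n^'n \<Rightarrow> real)"
    by (simp add: continuous_on_def tendsto_det)
  then have "open (det -` (- {0 :: real}) :: (real^'n^'n) set)"
    by (intro open_vimage) auto
  moreover have "det -` (- {0 :: real}) = {A :: real^'n^'n. invertible A}"
    by (auto simp: invertible_det_nz)
  ultimately show ?thesis by simp
qed

lemma tendsto_matrix_inv:
  fixes A :: "'a \<Rightarrow> real^'n^'n"
  assumes A: "(A \<longlongrightarrow> B) L" and B: "invertible B"
  shows "((\<lambda>x. matrix_inv (A x)) \<longlongrightarrow> matrix_inv B) L"
proof (intro vec_tendstoI)
  fix k l
  have "det B \<noteq> 0" using B by (simp add: invertible_det_nz)
  have ev: "\<forall>\<^sub>F x in L. invertible (A x)"
    using topological_tendstoD[OF A open_invertible] B by simp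
  have "((\<lambda>x. (\<chi> i j. if j = k then (if i = l then 1 else 0) else A x $ i $ j) :: real^'n^'n)
      \<longlongrightarrow> (\<chi> i j. if j = k then (if i = l then 1 else 0) else B $ i $ j)) L"
    by (intro vec_tendstoI) (auto simp: tendsto_vec_nth[OF tendsto_vec_nth[OF A]])
  then have "((\<lambda>x. det (\<chi> i j. if j = k then (if i = l then 1 else 0) else A x $ i $ j) / det (A x))
      \<longlongrightarrow> matrix_inv B $ k $ l) L"
    unfolding matrix_inv_cramer[OF B] using \<open>det B \<noteq> 0\<close>
    by (intro tendsto_divide tendsto_det A)
  then show "((\<lambda>x. matrix_inv (A x) $ k $ l) \<longlongrightarrow> matrix_inv B $ k $ l) L"
    by (rule Lim_transform_eventually)
      (use ev in eventually_elim, simp add: matrix_inv_cramer)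
qed

lemma rational_matrix_sequence:
  fixes A :: "real^'n^'n"
  assumes "invertible A"
  obtains B where "\<And>m. invertible (B m)" "\<And>m i j. (B m :: real^'n^'n) $ i $ j \<in> \<rat>" "B \<longlonglongrightarrow> (A :: real^'n^'n)"
proof -
  have "\<exists>f. (\<forall>m::nat. f m \<in> \<rat>) \<and> f \<longlonglongrightarrow> x" for x :: real
    by (simp add: Rats_closure_real flip: closure_sequential)
  then obtain f where f: "\<And>x m. f x (m::nat) \<in> \<rat>" "\<And>x :: real. f x \<longlonglongrightarrow> x"
    by metis
  define C where "C m = (\<chi> i j. f (A $ i $ j) m)" for m
  have C: "C \<longlonglongrightarrow> A"
    unfolding C_def by (intro vec_tendstoI) (simp add: f)
  have "\<forall>\<^sub>F m in sequentially. invertible (C m)"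
    using topological_tendstoD[OF C open_invertible] assms by simp
  then obtain M where M: "\<And>m. m \<ge> M \<Longrightarrow> invertible (C m)"
    by (auto simp: eventually_sequentially)
  \<comment> \<open>Approximants are invertible only from index \<open>M\<close> on, so the sequence
    is shifted by \<open>M\<close>.\<close>
  show ?thesis
    by (rule that[of "\<lambda>m. C (m + M)"]) (use M LIMSEQ_ignore_initial_segment[OF C, of M] in \<open>auto simp: C_def f\<close>)
qed

section \<open>Closed normal subgroups of the real general linear group\<close>

text \<open>\<open>K\<close> is closed relative to GL(n,\<real>), and \<open>div\<close> makes it a
  subgroup as soon as it has an element. Only rational conjugators are required, because in the
  applications just the conjugations by GL(n,F) are at hand; density of the rationals and closedness
  then give all real conjugators.\<close>

locale closed_normal_GL =
  fixes K :: "(real^'n^'n) set"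
  assumes invertible: "A \<in> K \<Longrightarrow> invertible A"
    and closed: "A \<in> closure K \<Longrightarrow> invertible A \<Longrightarrow> A \<in> K"
    and div: "A \<in> K \<Longrightarrow> B \<in> K \<Longrightarrow> A ** matrix_inv B \<in> K"
    and rational_conj:
      "A \<in> K \<Longrightarrow> invertible g \<Longrightarrow> (\<And>i j. g $ i $ j \<in> \<rat>) \<Longrightarrow> g ** A ** matrix_inv g \<in> K"
begin

lemma limit:
  assumes "\<And>m. S m \<in> K"
   "S \<longlonglongrightarrow> A" "invertible A"
  shows "A \<in> K"
  using assms closed closure_sequential by blast

lemma conj:
  assumes A: "A \<in> K" and g: "invertible g"
  shows "g ** A ** matrix_inv g \<in> K"
proof -
  obtain h where h: "\<And>m. invertible (h m)" "\<And>m i j. (h m :: real^'n^'n) $ i $ j \<in> \<rat>" "h \<longlonglongrightarrow> g"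
    using rational_matrix_sequence[OF g] by metis
  show ?thesis
  proof (rule limit)
    show "h m ** A ** matrix_inv (h m) \<in> K" for m
      by (intro rational_conj A h)
    show "(\<lambda>m. h m ** A ** matrix_inv (h m)) \<longlonglongrightarrow> g ** A ** matrix_inv g"
      by (intro tendsto_matrix_mult tendsto_matrix_inv tendsto_const h g)
    show "invertible (g ** A ** matrix_inv g)"
      using A g by (simp add: invertible_mult invertible_matrix_inv invertible)
  qed
qed

lemma one: "A \<in> K \<Longrightarrow> mat 1 \<in> K"
  using div[of A A] by (simp add: matrix_inv_works invertible)

lemma inv: "A \<in> K \<Longrightarrow> matrix_inv A \<in> K"
  using div[of "mat 1" A] one by simp

lemma mult: "A \<in> K \<Longrightarrow> B \<in> K \<Longrightarrow> A ** B \<in> K"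
  using div[of A "matrix_inv B"] inv[of B] by (simp add: matrix_inv_involutive invertible)

end

lemma perm_inverse:
  assumes "\<sigma> permutes (UNIV :: 'n::finite set)"
  shows "invertible (perm_mat \<sigma> :: real^'n^'n)"
    "(perm_mat \<sigma> ** A ** matrix_inv (perm_mat \<sigma>)) $ i $ j = A $ \<sigma> i $ \<sigma> j"
proof -
  have bij: "bij \<sigma>" using assms by (rule permutes_bij)
  let ?Q = "perm_mat (inv_into UNIV \<sigma>) :: real^'n^'n"
  have *: "perm_mat \<sigma> ** ?Q = mat 1" "?Q ** perm_mat \<sigma> = mat 1"
    using bij by (auto simp: vec_eq_iff mat_nth bij_is_inj bij_is_surj surj_f_inv_f)
  show "invertible (perm_mat \<sigma> :: real^'n^'n)" using * by (rule invertibleI)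
  have "(B ** ?Q) $ i $ j = B $ i $ \<sigma> j" for B :: "real^'n^'n"
  proof -
    have "j = inv_into UNIV \<sigma> k \<longleftrightarrow> k = \<sigma> j" for k
      using bij by (metis bij_inv_eq_iff)
    then show ?thesis
      by (simp add: mult_nth if_distrib [of "\<lambda>x. y * x" for y] cong: if_cong)
  qed
  then show "(perm_mat \<sigma> ** A ** matrix_inv (perm_mat \<sigma>)) $ i $ j = A $ \<sigma> i $ \<sigma> j"
    by (simp add: matrix_inv_eqI[OF *])
qed

text \<open>A nonscalar matrix either has a nonzero off-diagonal entry or is diagonal with two
  different diagonal entries; in the second case conjugation by a transvection produces their
  difference off the diagonal. Conjugation by a permutation matrix then carries the entry to the
  prescribed place.\<close>

lemma nonscalar_conj_entry:
  fixes A :: "real^'n^'n" and p q :: 'n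
  assumes A: "\<And>c. A \<noteq> mat c" and pq: "p \<noteq> q"
  obtains g :: "real^'n^'n" where "invertible g" "(g ** A ** matrix_inv g) $ p $ q \<noteq> 0"
proof -
  have "\<exists>(h :: real^'n^'n) i j. invertible h \<and> i \<noteq> j \<and> (h ** A ** matrix_inv h) $ i $ j \<noteq> 0"
  proof (cases "\<exists>i j. i \<noteq> j \<and> A $ i $ j \<noteq> 0")
    case True
    then obtain i j where "i \<noteq> j" "A $ i $ j \<noteq> 0" by blast
    then have "invertible (mat 1 :: real^'n^'n) \<and> i \<noteq> j \<and> (mat 1 ** A ** matrix_inv (mat 1)) $ i $ j \<noteq> 0"
      by simp
    then show ?thesis by blast
  next
    case False
    then have off: "A $ i $ j = 0" if "i \<noteq> j" for i j
      using that by blast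
    have "A \<noteq> mat (A $ p $ p)" by (rule A)
    then obtain i where "A $ i $ i \<noteq> A $ p $ p"
      using off by (auto simp: vec_eq_iff mat_nth split: if_splits)
    then have i: "i \<noteq> p" and ne: "A $ i $ i \<noteq> A $ p $ p" by auto
    let ?h = "mat 1 + single_mat i p 1"
    have "(?h ** A ** matrix_inv ?h) $ i $ p = A $ p $ p - A $ i $ i"
      using i by (simp add: transvection_inverse matrix_ring_simps off)
    then show ?thesis
      using i ne transvection_inverse(1)[OF i, of 1]
      by (intro exI[of _ ?h] exI[of _ i] exI[of _ p]) auto
  qed
  then obtain h :: "real^'n^'n" and i j where h: "invertible h" and "i \<noteq> j" and hij: "(h ** A ** matrix_inv h) $ i $ j \<noteq> 0"
    by blast
  let ?a = "Transposition.transpose p i"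
  \<comment> \<open>The inner swap sends \<open>p\<close> to \<open>i\<close> and \<open>q\<close>
    to some index other than \<open>i\<close>; the outer swap moves that index to \<open>j\<close>
    and leaves \<open>i\<close> alone.\<close>
  let ?s = "Transposition.transpose (?a q) j \<circ> ?a"
  have perm: "?s permutes UNIV"
    by (intro permutes_compose permutes_swap_id) auto
  have "?a q \<noteq> i"
    using pq by (metis transpose_involutory transpose_apply_second)
  then have s: "?s p = i" "?s q = j"
    using \<open>i \<noteq> j\<close> by (auto simp: transpose_apply_other)
  let ?P = "perm_mat ?s :: real^'n^'n"
  have "(?P ** h) ** A ** matrix_inv (?P ** h) = ?P ** (h ** A ** matrix_inv h) ** matrix_inv ?P"
    using perm_inverse(1)[OF perm] h by (simp add: matrix_inv_mult matrix_mul_assoc)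
  then have "((?P ** h) ** A ** matrix_inv (?P ** h)) $ p $ q \<noteq> 0"
    using hij s by (simp add: perm_inverse(2)[OF perm])
  moreover have "invertible (?P ** h)"
    using perm_inverse(1)[OF perm] h by (rule invertible_mult)
  ultimately show ?thesis using that by blast
qed

context closed_normal_GL
begin

text \<open>The commutators of a conjugate of \<open>k\<close> with \<open>1 + t E\<^sub>q\<^sub>j\<close> tend to \<open>1\<close> as \<open>t \<rightarrow> 0\<close>. Conjugating them by a diagonal
  matrix with entries \<open>s\<close> at \<open>p\<close> and \<open>1 / s\<close> at \<open>q\<close>, where \<open>t = d / s\<^sup>2\<close>, multiplies only the
  entry \<open>(p, q)\<close> by \<open>s\<^sup>2\<close>, so that in the limit \<open>s \<rightarrow> \<infinity>\<close> only this entry survives.\<close>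

lemma transvection_mem:
  assumes k: "k \<in> K" "\<And>c. k \<noteq> mat c" and pq: "p \<noteq> q"
  shows "mat 1 + single_mat p q c \<in> K"
proof -
  obtain g where g: "invertible g" "(g ** k ** matrix_inv g) $ p $ q \<noteq> 0"
    using nonscalar_conj_entry[OF k(2) pq] by metis
  define k' where "k' = g ** k ** matrix_inv g"
  define h where "h = matrix_inv k'"
  have k': "k' \<in> K" "invertible k'" "k' $ p $ q \<noteq> 0"
    using conj[OF k(1) g(1)] g(2) invertible unfolding k'_def by auto
  \<comment> \<open>If column \<open>q\<close> of \<open>h\<close> were a multiple of the basis
    vector e_q, then \<open>k' ** h = mat 1\<close> would make column \<open>q\<close> of
    \<open>k'\<close> one as well, against \<open>k' $ p $ q \<noteq> 0\<close>.\<close>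
  have "\<exists>j. j \<noteq> q \<and> h $ j $ q \<noteq> 0"
  proof (rule ccontr)
    assume "\<not> ?thesis"
    then have 0: "h $ j $ q = (if j = q then h $ q $ q else 0)" for j by auto
    have "(k' ** h) $ i $ q = k' $ i $ q * h $ q $ q" for i
      unfolding mult_nth by (subst 0) (simp add: if_distrib [of "\<lambda>x. y * x" for y] cong: if_cong)
    moreover have "k' ** h = mat 1"
      unfolding h_def using k'(2) by (simp add: matrix_inv_works)
    ultimately have "k' $ p $ q * h $ q $ q = 0" "k' $ q $ q * h $ q $ q = 1"
      using pq by (metis mat_nth)+
    then show False using k'(3) by auto
  qed
  then obtain j where j: "j \<noteq> q" "h $ j $ q \<noteq> 0" by blast
  let ?E = "\<lambda>t. single_mat q j t"
  \<comment> \<open>\<open>S\<close> and \<open>- Z\<close> are the coefficients of t and t^2 in the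
    commutator of \<open>k'\<close> and 1 + t E_qj. There are no higher terms because E_qj squares
    to zero, so that the inverse of 1 + t E_qj is 1 - t E_qj.\<close>
  define S where "S = k' ** ?E 1 ** h - ?E 1"
  define Z where "Z = k' ** ?E 1 ** h ** ?E 1"
  have Spq: "S $ p $ q = k' $ p $ q * h $ j $ q"
  proof -
    have "S $ p $ q = (k' ** ?E 1 ** h) $ p $ q"
      using pq by (simp add: S_def)
    also have "\<dots> = (\<Sum>l\<in>UNIV. (if l = j then k' $ p $ q * h $ j $ q else 0))"
      unfolding mult_nth[of "k' ** ?E 1"] by (intro sum.cong) auto
    finally show ?thesis by simp
  qed
  have commutator: "mat 1 + t *\<^sub>R S - (t * t) *\<^sub>R Z \<in> K" for t
  proof -
    have E: "?E t = t *\<^sub>R ?E 1" by (simp add: vec_eq_iff)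
    let ?T = "mat 1 + ?E t"
    note T = transvection_inverse[OF j(1)[symmetric], of t]
    have "?T ** matrix_inv k' ** matrix_inv ?T \<in> K"
      by (intro conj inv k'(1) T(1))
    then have "k' ** (?T ** matrix_inv k' ** matrix_inv ?T) \<in> K"
      by (rule mult[OF k'(1)])
    also have "k' ** (?T ** matrix_inv k' ** matrix_inv ?T)
        = (k' ** h + t *\<^sub>R (k' ** ?E 1 ** h)) ** (mat 1 - t *\<^sub>R ?E 1)"
      unfolding T(2) h_def[symmetric] unfolding E by (simp add: matrix_ring_simps)
    also have "\<dots> = mat 1 + t *\<^sub>R S - (t * t) *\<^sub>R Z"
      using matrix_inv_works(1)[OF k'(2)]
      by (simp add: h_def[symmetric] S_def Z_def matrix_ring_simps algebra_simps)
    finally show ?thesis .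
  qed
  define x where "x = S $ p $ q"
  have "x \<noteq> 0" using k'(3) j(2) by (simp add: x_def Spq)
  \<comment> \<open>This choice makes the surviving entry equal to \<open>d * x = c\<close>.\<close>
  define d where "d = c / x"
  define r where "r m = inverse (real (Suc m))" for m
  define f where "f m i = (if i = p then inverse (r m) else if i = q then r m else 1)" for m i
  have r: "r m \<noteq> 0" for m by (simp add: r_def)
  have r0: "r \<longlonglongrightarrow> 0" unfolding r_def by (rule LIMSEQ_inverse_real_of_nat)
  have f: "f m i \<noteq> 0" for m i by (simp add: f_def r)
  define Y where "Y m = diag_mat (f m) ** (mat 1 + (d * (r m)\<^sup>2) *\<^sub>R S
    - ((d * (r m)\<^sup>2) * (d * (r m)\<^sup>2)) *\<^sub>R Z) ** matrix_inv (diag_mat (f m))" for m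
  show ?thesis
  proof (rule limit)
    show "Y m \<in> K" for m
      unfolding Y_def by (intro conj commutator diag_inverse f)
    show "invertible (mat 1 + single_mat p q c)"
      by (rule transvection_inverse[OF pq])
    show "Y \<longlonglongrightarrow> mat 1 + single_mat p q c"
    proof (intro vec_tendstoI)
      fix a b
      \<comment> \<open>\<open>w m\<close> is \<open>(r m)\<^sup>2 * f m a / f m b\<close>, split so
        that both factors converge: the first to 1 if a = p and to 0 otherwise, the second to 1 if b
        = q and to 0 otherwise. The quadratic term carries a further \<open>(r m)\<^sup>2\<close>
        and vanishes.\<close>
      define w where "w m = (f m a * r m) * (r m * inverse (f m b))" for m
      have Yab: "Y m $ a $ b = (if a = b then 1 else 0) + d * w m * S $ a $ b
          - d\<^sup>2 * (r m)\<^sup>2 * w m * Z $ a $ b" for m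
        using f[of m] by (auto simp: Y_def w_def diag_inverse mat_nth algebra_simps power2_eq_square)
      have "(\<lambda>m. f m a * r m) = (\<lambda>m. if a = p then 1 else if a = q then r m * r m else r m)"
        using r by (auto simp: f_def)
      moreover have "(\<lambda>m. if a = p then 1 else if a = q then r m * r m else r m) \<longlonglongrightarrow> (if a = p then 1 else 0)"
        by (cases "a = p"; cases "a = q") (simp_all add: tendsto_mult_zero r0)
      moreover have "(\<lambda>m. r m * inverse (f m b)) = (\<lambda>m. if b = q then 1 else if b = p then r m * r m else r m)"
        using r pq by (auto simp: f_def)
      moreover have "(\<lambda>m. if b = q then 1 else if b = p then r m * r m else r m) \<longlonglongrightarrow> (if b = q then 1 else 0)"
        by (cases "b = p"; cases "b = q") (simp_all add: tendsto_mult_zero r0)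
      ultimately have w: "w \<longlonglongrightarrow> (if a = p then 1 else 0) * (if b = q then 1 else 0)"
        unfolding w_def by (intro tendsto_mult) simp_all
      have "(\<lambda>m. Y m $ a $ b) \<longlonglongrightarrow> (if a = b then 1 else 0)
          + d * ((if a = p then 1 else 0) * (if b = q then 1 else 0)) * S $ a $ b
          - d\<^sup>2 * 0\<^sup>2 * ((if a = p then 1 else 0) * (if b = q then 1 else 0)) * Z $ a $ b"
        unfolding Yab by (intro tendsto_add tendsto_diff tendsto_mult tendsto_const tendsto_power w r0)
      moreover have "(if a = b then 1 else 0)
          + d * ((if a = p then 1 else 0) * (if b = q then 1 else 0)) * S $ a $ b
          - d\<^sup>2 * 0\<^sup>2 * ((if a = p then 1 else 0) * (if b = q then 1 else 0)) * Z $ a $ b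
        = (mat 1 + single_mat p q c) $ a $ b"
        using \<open>x \<noteq> 0\<close> pq by (auto simp: mat_nth d_def x_def)
      ultimately show "(\<lambda>m. Y m $ a $ b) \<longlonglongrightarrow> (mat 1 + single_mat p q c) $ a $ b"
        by (simp only:)
    qed
  qed
qed

end

text \<open>Row reduction writes an invertible matrix as a product of transvections, transpositions
  and diagonal matrices. Transpositions are signed ones, built from transvections, times a diagonal
  sign, so the diagonal matrices are the real issue, and there the scalars and the oddness of the
  dimension are used.\<close>

lemma (in closed_normal_GL) contains_GL:
  fixes A :: "real^'n^'n"
  assumes trans: "\<And>p q c. p \<noteq> q \<Longrightarrow> mat 1 + single_mat p q c \<in> K"
    and scalar: "\<And>c. c \<noteq> 0 \<Longrightarrow> mat c \<in> K"
    and odd: "odd CARD('n)" and A: "invertible A"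
  shows "A \<in> K"
proof -
  \<comment> \<open>The matrix (0 1; -1 0) in the plane of the coordinates i and j: a transposition
    with a sign, hence of determinant 1.\<close>
  define w where "w i j = ((\<chi> x y. if x = i then (if y = j then 1 else 0)
      else if x = j then (if y = i then - 1 else 0) else (if x = y then 1 else 0)) :: real^'n^'n)" for i j :: 'n
  have w: "w i j \<in> K" if "i \<noteq> j" for i j
  proof -
    have "(mat 1 + single_mat i j 1) ** ((mat 1 + single_mat j i (- 1)) ** (mat 1 + single_mat i j 1)) \<in> K"
      using that by (intro mult trans) auto
    also have "(mat 1 + single_mat i j 1) ** ((mat 1 + single_mat j i (- 1)) ** (mat 1 + single_mat i j 1))
        = w i j"
      using that by (auto simp: vec_eq_iff w_def mat_nth matrix_add_ldistrib matrix_mult_add_left)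
    finally show ?thesis .
  qed
  have pair: "diag_mat (\<lambda>x. if x = i then c else if x = j then inverse c else 1) \<in> K"
    (is "?h \<in> K") if "i \<noteq> j" "c \<noteq> 0" for i j c
  proof -
    let ?g = "diag_mat (\<lambda>x. if x = i then c else 1) :: real^'n^'n"
    have g: "invertible ?g" "matrix_inv ?g = diag_mat (\<lambda>x. inverse (if x = i then c else 1))"
      by (rule diag_inverse; use that in \<open>auto split: if_splits\<close>)+
    \<comment> \<open>So \<open>?h\<close> is the commutator of \<open>?g\<close> and
      \<open>w i j\<close>. It lies in \<open>K\<close> by normality, although \<open>?g\<close> is
      not yet known to.\<close>
    have "?g ** w i j ** matrix_inv ?g = ?h ** w i j"
      unfolding g(2) vec_eq_iff
    proof (intro allI)
      fix x y
      show "(?g ** w i j ** diag_mat (\<lambda>x. inverse (if x = i then c else 1))) $ x $ y = (?h ** w i j) $ x $ y"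
        using that by (cases "x = i"; cases "x = j"; cases "y = i"; cases "y = j") (simp_all add: w_def)
    qed
    then have "?h = ?g ** w i j ** matrix_inv ?g ** matrix_inv (w i j)"
      using invertible[OF w[OF that(1)]] by (simp add: matrix_inv_mult_cancel)
    also have "\<dots> \<in> K" using that g by (intro div conj w) auto
    finally show ?thesis .
  qed
  \<comment> \<open>The slot \<open>a\<close> outside \<open>I\<close> absorbs the inverse of the
    product, which keeps the determinant 1; each induction step multiplies by one matrix from
    \<open>pair\<close>.\<close>
  have det_one: "diag_mat (\<lambda>x. if x \<in> I then f x else if x = a then inverse (\<Prod>i\<in>I. f i) else 1) \<in> K"
    if "\<And>i. f i \<noteq> 0" "a \<notin> I" for I a and f :: "'n \<Rightarrow> real"
    using finite[of I] that(2)
  proof (induction I rule: finite_induct)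
    case empty
    have "diag_mat (\<lambda>x. 1) = (mat 1 :: real^'n^'n)" by (simp add: vec_eq_iff mat_nth)
    then show ?case using scalar[of 1] by (simp cong: if_cong)
  next
    case (insert b I)
    let ?d = "diag_mat (\<lambda>x. if x \<in> I then f x else if x = a then inverse (\<Prod>i\<in>I. f i) else 1)"
    let ?h = "diag_mat (\<lambda>x. if x = b then f b else if x = a then inverse (f b) else 1)"
    have "?h ** ?d \<in> K"
      using insert that(1) by (intro mult pair) auto
    also have "?h ** ?d = diag_mat (\<lambda>x. if x \<in> insert b I then f x
        else if x = a then inverse (\<Prod>i\<in>insert b I. f i) else 1)"
      using insert by (auto simp: vec_eq_iff)
    finally show ?case .
  qed
  have diag: "diag_mat f \<in> K" if f: "\<And>i. f i \<noteq> 0" for f :: "'n \<Rightarrow> real"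
  proof -
    \<comment> \<open>For odd n the root exists whatever the sign of the determinant. Dividing by
      \<open>l\<close> leaves a diagonal matrix of determinant 1, to which \<open>det_one\<close>
      applies with all indices but one in \<open>I\<close>.\<close>
    define l where "l = root CARD('n) (\<Prod>i\<in>UNIV. f i)"
    have l: "l ^ CARD('n) = (\<Prod>i\<in>UNIV. f i)"
      using odd by (simp add: l_def odd_real_root_pow)
    then have "l \<noteq> 0" using f by (auto simp: power_0_left split: if_splits)
    fix a :: 'n
    have "(\<Prod>i\<in>UNIV. f i / l) = 1"
      using l \<open>l \<noteq> 0\<close> f by (simp add: prod_dividef)
    then have "(f a / l) * (\<Prod>i\<in>- {a}. f i / l) = 1"
      by (subst (asm) prod.remove[of _ a]) (simp_all flip: Compl_eq_Diff_UNIV)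
    then have a: "inverse (\<Prod>i\<in>- {a}. f i / l) = f a / l"
      by (metis inverse_unique mult.commute)
    have "mat l ** diag_mat (\<lambda>x. if x \<in> - {a} then f x / l
        else if x = a then inverse (\<Prod>i\<in>- {a}. f i / l) else 1) \<in> K"
      using f \<open>l \<noteq> 0\<close> by (intro mult scalar det_one) auto
    also have "mat l ** diag_mat (\<lambda>x. if x \<in> - {a} then f x / l
        else if x = a then inverse (\<Prod>i\<in>- {a}. f i / l) else 1) = diag_mat f"
      unfolding a using \<open>l \<noteq> 0\<close> by (auto simp: vec_eq_iff mat_nth)
    finally show ?thesis .
  qed
  have "invertible A \<longrightarrow> A \<in> K"
  proof (induction rule: induct_matrix_elementary[of "\<lambda>A. invertible A \<longrightarrow> A \<in> K"])
    case (1 A B)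
    show ?case
    proof
      assume "invertible (A ** B)"
      then have "invertible A" "invertible B"
        by (simp_all add: invertible_det_nz det_mul)
      then show "A ** B \<in> K" using 1 by (auto intro: mult)
    qed
  next
    case (2 A i)
    then show ?case by (simp add: invertible_det_nz det_zero_row)
  next
    case (3 A)
    have Adiag: "A = diag_mat (\<lambda>i. A $ i $ i)" using 3 by (simp add: vec_eq_iff)
    have nz: "A $ i $ i \<noteq> 0" if "invertible A" for i
    proof -
      have "diag_mat (\<lambda>i. A $ i $ i) ** matrix_inv A = mat 1"
        using matrix_inv_works(1)[OF that] by (subst Adiag[symmetric])
      then have "(diag_mat (\<lambda>i. A $ i $ i) ** matrix_inv A) $ i $ i = 1"
        by (simp add: mat_nth del: diag_mult_nth)
      then have "A $ i $ i * matrix_inv A $ i $ i = 1"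
        by (simp only: diag_mult_nth)
      then show ?thesis by (metis mult_zero_left zero_neq_one)
    qed
    show ?case
    proof
      assume "invertible A"
      then have "diag_mat (\<lambda>i. A $ i $ i) \<in> K" by (intro diag nz)
      then show "A \<in> K" by (subst Adiag)
    qed
  next
    case (4 m n)
    \<comment> \<open>\<open>w m n\<close> is the transposition matrix up to the sign in row
      \<open>n\<close>.\<close>
    have "diag_mat (\<lambda>x. if x = n then - 1 else 1) ** w m n \<in> K"
      by (rule mult[OF diag w[OF 4]]) simp
    also have "diag_mat (\<lambda>x. if x = n then - 1 else 1) ** w m n
        = (\<chi> i j. mat 1 $ i $ Transposition.transpose m n j)"
      unfolding vec_eq_iff
    proof (intro allI)
      fix x y
      show "(diag_mat (\<lambda>x. if x = n then - 1 else 1) ** w m n) $ x $ y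
          = (\<chi> i j. mat 1 $ i $ Transposition.transpose m n j) $ x $ y"
        using 4 by (cases "x = m"; cases "x = n"; cases "y = m"; cases "y = n")
          (auto simp: w_def mat_nth transpose_apply_other)
    qed
    finally show ?case by simp
  next
    case (5 m n c)
    have "(\<chi> i j. if i = m \<and> j = n then c else of_bool (i = j)) = mat 1 + single_mat m n c"
      using 5 by (auto simp: vec_eq_iff mat_nth)
    then show ?case using trans[OF 5] by simp
  qed
  then show ?thesis using A by simp
qed

text \<open>Directedness gives the traces of the closures on \<open>Q\<close> the finite
  intersection property. This replaces convergent subnets: the families used below need not have
  countable bases.\<close>

lemma directed_accumulation:
  fixes Q :: "'a::topological_space set"
  assumes Q: "compact Q" and ne: "\<V> \<noteq> {}"
    and dir: "\<And>V W. V \<in> \<V> \<Longrightarrow> W \<in> \<V> \<Longrightarrow> \<exists>U\<in>\<V>. U \<subseteq> V \<inter> W"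
    and meets: "\<And>V. V \<in> \<V> \<Longrightarrow> V \<inter> Q \<noteq> {}"
  obtains x where "x \<in> Q" "\<And>V. V \<in> \<V> \<Longrightarrow> x \<in> closure V"
proof -
  have "Q \<inter> \<Inter>(closure ` \<V>) \<noteq> {}"
  proof (rule compact_imp_fip[OF Q])
    fix \<F> assume "finite \<F>" "\<F> \<subseteq> closure ` \<V>"
    then obtain \<W> where \<W>: "\<W> \<subseteq> \<V>" "finite \<W>" "\<F> = closure ` \<W>"
      by (meson finite_subset_image)
    from \<W>(2,1) have "\<exists>U\<in>\<V>. \<forall>W\<in>\<W>. U \<subseteq> W"
    proof (induction rule: finite_induct)
      case empty
      then show ?case using ne by auto
    next
      case (insert W \<W>)
      then obtain U where "U \<in> \<V>" and U: "\<forall>W\<in>\<W>. U \<subseteq> W" by auto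
      moreover obtain U' where "U' \<in> \<V>" "U' \<subseteq> U \<inter> W"
        using dir[of U W] \<open>U \<in> \<V>\<close> insert.prems by auto
      ultimately show ?case using U by blast
    qed
    then obtain U where U: "U \<in> \<V>" "\<forall>W\<in>\<W>. U \<subseteq> W" by blast
    then obtain x where "x \<in> U" "x \<in> Q" using meets[OF U(1)] by blast
    moreover have "x \<in> closure W" if "W \<in> \<W>" for W
      using U(2) that \<open>x \<in> U\<close> closure_subset[of W] by blast
    ultimately show "Q \<inter> \<Inter>\<F> \<noteq> {}"
      unfolding \<W>(3) by blast
  qed auto
  then obtain x where "x \<in> Q" "\<forall>V\<in>\<V>. x \<in> closure V" by auto
  then show ?thesis by (intro that) auto
qed

section \<open>Compact sets of matrices and bounds on entries\<close>

lemma continuous_on_matrix_mult [continuous_intros]: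
  fixes f :: "'a::topological_space \<Rightarrow> real^'n^'m" and g :: "'a \<Rightarrow> real^'k^'n"
  assumes "continuous_on S f" "continuous_on S g"
  shows "continuous_on S (\<lambda>x. f x ** g x)"
  using assms unfolding continuous_on_def by (auto intro: tendsto_matrix_mult)

lemma norm_matrix_le: "norm (A :: real^'n^'m) \<le> (\<Sum>i\<in>UNIV. \<Sum>j\<in>UNIV. \<bar>A $ i $ j\<bar>)"
proof -
  have "norm A \<le> (\<Sum>i\<in>UNIV. norm (A $ i))"
    unfolding norm_vec_def by (rule L2_set_le_sum) auto
  also have "\<dots> \<le> (\<Sum>i\<in>UNIV. \<Sum>j\<in>UNIV. \<bar>A $ i $ j\<bar>)"
    by (intro sum_mono norm_le_l1_cart)
  finally show ?thesis .
qed

lemma compact_entries_le: "compact {A :: real^'n^'m. \<forall>i j. \<bar>A $ i $ j\<bar> \<le> C}"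
  unfolding compact_eq_bounded_closed
proof
  show "bounded {A :: real^'n^'m. \<forall>i j. \<bar>A $ i $ j\<bar> \<le> C}"
    unfolding bounded_iff
  proof (intro exI[of _ "(\<Sum>i\<in>(UNIV::'m set). \<Sum>j\<in>(UNIV::'n set). C)"] ballI)
    fix A :: "real^'n^'m" assume "A \<in> {A. \<forall>i j. \<bar>A $ i $ j\<bar> \<le> C}"
    then have "(\<Sum>i\<in>UNIV. \<Sum>j\<in>UNIV. \<bar>A $ i $ j\<bar>) \<le> (\<Sum>i\<in>(UNIV::'m set). \<Sum>j\<in>(UNIV::'n set). C)"
      by (intro sum_mono) auto
    with norm_matrix_le[of A] show "norm A \<le> (\<Sum>i\<in>(UNIV::'m set). \<Sum>j\<in>(UNIV::'n set). C)"
      by linarith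
  qed
  show "closed {A :: real^'n^'m. \<forall>i j. \<bar>A $ i $ j\<bar> \<le> C}"
    by (intro closed_Collect_all closed_Collect_le continuous_intros)
qed

text \<open>Bounding the entries of \<open>A\<close> alone does not prevent a limit from being
  singular. With the inverse bounded too, the set is the projection of a compact set of pairs (A, B)
  with A B = B A = 1.\<close>

lemma compact_invertible_entries_le:
  "compact {A :: real^'n^'n. invertible A \<and> (\<forall>i j. \<bar>A $ i $ j\<bar> \<le> C) \<and> (\<forall>i j. \<bar>matrix_inv A $ i $ j\<bar> \<le> D)}"
    (is "compact ?Q")
proof -
  let ?R = "({A :: real^'n^'n. \<forall>i j. \<bar>A $ i $ j\<bar> \<le> C} \<times> {A :: real^'n^'n. \<forall>i j. \<bar>A $ i $ j\<bar> \<le> D})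
    \<inter> ({p. fst p ** snd p = mat 1} \<inter> {p. snd p ** fst p = mat 1})"
  have "closed ({p :: (real^'n^'n) \<times> (real^'n^'n). fst p ** snd p = mat 1} \<inter> {p. snd p ** fst p = mat 1})"
    by (intro closed_Int closed_Collect_eq continuous_intros)
  then have "compact (fst ` ?R)"
    by (intro compact_continuous_image compact_Int_closed compact_Times compact_entries_le
        closed_Collect_eq continuous_intros)
  also have "fst ` ?R = ?Q"
  proof (intro equalityI subsetI)
    fix A assume "A \<in> fst ` ?R"
    then obtain B where AB: "A ** B = mat 1" "B ** A = mat 1"
        and bounds: "\<forall>i j. \<bar>A $ i $ j\<bar> \<le> C" "\<forall>i j. \<bar>B $ i $ j\<bar> \<le> D"
      by auto
    show "A \<in> ?Q"
      using bounds invertibleI[OF AB] by (simp add: matrix_inv_eqI[OF AB])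
  next
    fix A assume "A \<in> ?Q"
    then show "A \<in> fst ` ?R"
      by (intro image_eqI[of _ _ "(A, matrix_inv A)"]) (auto simp: matrix_inv_works)
  qed
  finally show ?thesis .
qed

text \<open>For i = j pick l \<noteq> i. Since the diagonal entry (l, l) of \<open>h ** g\<close> is
  1, some c satisfies |h_lc g_cl| \<ge> 1/n. Multiplying by n times this quantity and regrouping,
  |g_ai h_ib| \<le> n |g_ai h_lc| |g_cl h_ib|, and both factors on the right are off-diagonal
  products. In dimension 1 there is no such l, but then the product is 1.\<close>

lemma entry_products_bounded:
  fixes g h :: "real^'n^'n"
  assumes hg: "h ** g = mat 1"
    and off: "\<And>a i j b. i \<noteq> j \<Longrightarrow> \<bar>g $ a $ i * h $ j $ b\<bar> \<le> B"
  shows "\<bar>g $ a $ i * h $ j $ b\<bar> \<le> max 1 (max B (real CARD('n) * (B * B)))"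
proof (cases "i = j")
  case False
  then show ?thesis using off[of i j a b] by linarith
next
  case True
  have sum1: "(\<Sum>a\<in>UNIV. h $ j $ a * g $ a $ j) = 1" for j
    using arg_cong[OF hg, of "\<lambda>M. M $ j $ j"] by (simp add: mult_nth mat_nth)
  show ?thesis
  proof (cases "\<exists>l. l \<noteq> i")
    case False
    then have UNIV: "UNIV = {i}" and "a = i" "b = i" by auto
    have "(\<Sum>a\<in>UNIV. h $ i $ a * g $ a $ i) = (\<Sum>a\<in>{i}. h $ i $ a * g $ a $ i)"
      by (rule sum.cong[OF UNIV refl])
    then have "g $ a $ i * h $ j $ b = 1"
      using sum1[of i] True \<open>a = i\<close> \<open>b = i\<close> by (simp add: mult.commute)
    then show ?thesis by simp
  next
    case l: True
    then obtain l where l: "l \<noteq> i" by blast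
    have "\<exists>c. 1 \<le> real CARD('n) * \<bar>h $ l $ c * g $ c $ l\<bar>"
    proof (rule ccontr)
      assume "\<not> ?thesis"
      then have "\<bar>h $ l $ c * g $ c $ l\<bar> < 1 / real CARD('n)" for c
        by (auto simp: field_simps not_le)
      then have "(\<Sum>c\<in>(UNIV::'n set). \<bar>h $ l $ c * g $ c $ l\<bar>) < (\<Sum>c\<in>(UNIV::'n set). 1 / real CARD('n))"
        by (intro sum_strict_mono) auto
      with sum_abs[of "\<lambda>c. h $ l $ c * g $ c $ l" UNIV] sum1[of l] show False by simp
    qed
    then obtain c where c: "1 \<le> real CARD('n) * \<bar>h $ l $ c * g $ c $ l\<bar>" by blast
    have "\<bar>g $ a $ i * h $ i $ b\<bar> \<le> \<bar>g $ a $ i * h $ i $ b\<bar> * (real CARD('n) * \<bar>h $ l $ c * g $ c $ l\<bar>)"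
      using mult_left_mono[OF c, of "\<bar>g $ a $ i * h $ i $ b\<bar>"] by simp
    also have "\<dots> = real CARD('n) * (\<bar>g $ a $ i * h $ l $ c\<bar> * \<bar>g $ c $ l * h $ i $ b\<bar>)"
      by (simp add: abs_mult mult_ac)
    also have "\<dots> \<le> real CARD('n) * (B * B)"
      using off[of i l a c] off[of l i c b] l by (intro mult_left_mono mult_mono') auto
    finally show ?thesis using True by simp
  qed
qed

text \<open>The exact factor 1 / M need not lie in \<open>F\<close>; a rational factor does, at the
  price of landing in [1, 2] instead of at 1.\<close>

lemma rational_normalization:
  fixes M :: real
  assumes "M > 0"
  obtains t where "t \<in> \<rat>" "0 < t" "1 \<le> t * M" "t * M \<le> 2"
proof -
  have "1 / M < 2 / M" using assms by (simp add: divide_strict_right_mono)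
  then obtain t where t: "t \<in> \<rat>" "1 / M < t" "t < 2 / M"
    using Rats_dense_in_real by blast
  have "0 < t" using t(2) assms by (meson divide_pos_pos less_trans zero_less_one)
  then show ?thesis using that[of t] t assms by (auto simp: field_simps)
qed

section \<open>Coarser group topologies\<close>

definition GL_set :: "real set \<Rightarrow> (real^'n^'n) set" where
  "GL_set F = {A. invertible A \<and> (\<forall>i j. A $ i $ j \<in> F)}"

locale real_subfield =
  fixes F :: "real set"
  assumes subfield: "subfield F real_ring"
begin

text \<open>The conventions \<open>inverse 0 = 0\<close> and \<open>x / 0 = 0\<close> allow closure
  under inversion and division to be stated without nonzero assumptions.\<close>

lemma F_closed:
  "0 \<in> F" "1 \<in> F" "x \<in> F \<Longrightarrow> y \<in> F \<Longrightarrow> x + y \<in> F" "x \<in> F \<Longrightarrow> y \<in> F \<Longrightarrow> x * y \<in> F"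
  "x \<in> F \<Longrightarrow> - x \<in> F" "x \<in> F \<Longrightarrow> inverse x \<in> F" "x \<in> F \<Longrightarrow> y \<in> F \<Longrightarrow> x - y \<in> F"
  "x \<in> F \<Longrightarrow> y \<in> F \<Longrightarrow> x / y \<in> F"
  using subfield unfolding subfield_real_ring_iff
  by (cases "x = 0"; cases "y = 0"; force simp: divide_inverse diff_conv_add_uminus simp del: add_uminus_conv_diff)+

lemma F_sum: "(\<And>i. i \<in> I \<Longrightarrow> f i \<in> F) \<Longrightarrow> sum f I \<in> F"
  by (induction I rule: infinite_finite_induct) (auto intro: F_closed)

lemma F_prod: "(\<And>i. i \<in> I \<Longrightarrow> f i \<in> F) \<Longrightarrow> prod f I \<in> F"
  by (induction I rule: infinite_finite_induct) (auto intro: F_closed)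

lemma F_rational: "x \<in> \<rat> \<Longrightarrow> x \<in> F"
proof -
  have nat: "real n \<in> F" for n by (induction n) (auto intro: F_closed)
  have int: "real_of_int n \<in> F" for n
    by (cases n) (auto intro: nat F_closed simp: algebra_simps simp del: of_nat_Suc)
  show "x \<in> F" if "x \<in> \<rat>"
    using that by (elim Rats_cases') (auto intro: F_closed int)
qed

lemma det_mem: "(\<And>i j. A $ i $ j \<in> F) \<Longrightarrow> det A \<in> F"
  unfolding det_def by (intro F_sum F_closed(4) F_prod) (auto intro: F_rational)

lemma GL_mult: "A \<in> GL_set F \<Longrightarrow> B \<in> GL_set F \<Longrightarrow> A ** B \<in> GL_set F"
  by (auto simp: GL_set_def mult_nth intro!: invertible_mult F_sum F_closed)

lemma GL_inv: "A \<in> GL_set F \<Longrightarrow> matrix_inv A \<in> GL_set F"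
  by (auto simp: GL_set_def matrix_inv_cramer intro!: invertible_matrix_inv det_mem F_closed)

lemma GL_scaleR: "A \<in> GL_set F \<Longrightarrow> c \<in> F \<Longrightarrow> c \<noteq> 0 \<Longrightarrow> c *\<^sub>R A \<in> GL_set F"
  by (auto simp: GL_set_def intro: scalar_inverse F_closed)

lemma GL_rational: "invertible A \<Longrightarrow> (\<And>i j. A $ i $ j \<in> \<rat>) \<Longrightarrow> A \<in> GL_set F"
  by (simp add: GL_set_def F_rational)

lemma GL_transvection: "i \<noteq> j \<Longrightarrow> t \<in> F \<Longrightarrow> mat 1 + single_mat i j t \<in> GL_set F"
  using transvection_inverse(1)[of i j t] by (auto simp: GL_set_def mat_nth intro: F_closed)

end

lemma transvection_nonscalar: "p \<noteq> q \<Longrightarrow> c \<noteq> 0 \<Longrightarrow> mat 1 + single_mat p q c \<noteq> mat d"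
proof
  assume "p \<noteq> q" "c \<noteq> 0" and eq: "mat 1 + single_mat p q c = mat d"
  show False
    using arg_cong[OF eq, of "\<lambda>M. M $ p $ q"] \<open>p \<noteq> q\<close> \<open>c \<noteq> 0\<close> by (simp add: mat_nth)
qed

lemma nonscalar_distinct_indices:
  fixes A :: "real^'n^'n"
  assumes "\<And>c. A \<noteq> mat c"
  obtains p q :: 'n where "p \<noteq> q"
proof (rule ccontr)
  assume "\<not> thesis"
  then have "p = q" for p q :: 'n using that by blast
  then have "A = mat (A $ undefined $ undefined)"
    by (simp add: vec_eq_iff mat_nth) metis
  then show False using assms by blast
qed

lemma closure_seq:
  fixes x :: "'a::metric_space"
  assumes "x \<in> closure V"
  obtains S where "\<And>m::nat. S m \<in> V" "S \<longlonglongrightarrow> x"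
  using assms unfolding closure_sequential by blast

text \<open>\<open>\<V>\<close> stands for the neighbourhoods of the identity in a coarser Hausdorff group topology on
  a quotient of the general linear group by scalars, pulled back to matrices.\<close>

locale scalar_group_nbhds = real_subfield +
  fixes \<V> :: "(real^'n^'n) set set"
  assumes nonempty: "\<V> \<noteq> {}"
    and subset_GL: "V \<in> \<V> \<Longrightarrow> V \<subseteq> GL_set F"
    and directed: "V \<in> \<V> \<Longrightarrow> W \<in> \<V> \<Longrightarrow> \<exists>U\<in>\<V>. U \<subseteq> V \<inter> W"
    and division: "V \<in> \<V> \<Longrightarrow> \<exists>W\<in>\<V>. \<forall>x\<in>W. \<forall>y\<in>W. x ** matrix_inv y \<in> V"
    and conjugation: "V \<in> \<V> \<Longrightarrow> g \<in> GL_set F \<Longrightarrow> \<exists>W\<in>\<V>. \<forall>x\<in>W. g ** x ** matrix_inv g \<in> V"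
    and open_nbhd: "V \<in> \<V> \<Longrightarrow> openin (top_of_set (GL_set F)) V"
    and one_mem: "V \<in> \<V> \<Longrightarrow> mat 1 \<in> V"
    and saturated: "V \<in> \<V> \<Longrightarrow> A \<in> V \<Longrightarrow> c \<in> F \<Longrightarrow> c \<noteq> 0 \<Longrightarrow> c *\<^sub>R A \<in> V"
    and separated: "A \<in> GL_set F \<Longrightarrow> (\<And>V. V \<in> \<V> \<Longrightarrow> A \<in> V) \<Longrightarrow> \<exists>c. A = mat c"
begin

section \<open>The closed normal subgroup attached to a coarser topology\<close>

definition core :: "(real^'n^'n) set" where
  "core = {A. invertible A \<and> (\<forall>V\<in>\<V>. A \<in> closure V)}"

lemma nbhd_invertible: "V \<in> \<V> \<Longrightarrow> A \<in> V \<Longrightarrow> invertible A"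
  using subset_GL by (auto simp: GL_set_def)

lemma core_closed_normal: "closed_normal_GL core"
proof
  show "invertible A" if "A \<in> core" for A
    using that by (simp add: core_def)
  show "A \<in> core" if "A \<in> closure core" "invertible A" for A
  proof -
    have "core \<subseteq> closure V" if "V \<in> \<V>" for V using that by (auto simp: core_def)
    then have "closure core \<subseteq> closure V" if "V \<in> \<V>" for V using that by (simp add: closure_minimal)
    then show ?thesis using that by (auto simp: core_def)
  qed
  show "A ** matrix_inv B \<in> core" if "A \<in> core" "B \<in> core" for A B
  proof -
    have AB: "invertible A" "invertible B" using that by (auto simp: core_def)
    have "A ** matrix_inv B \<in> closure V" if V: "V \<in> \<V>" for V
    proof -
      obtain W where W: "W \<in> \<V>" "\<forall>x\<in>W. \<forall>y\<in>W. x ** matrix_inv y \<in> V" using division[OF V] by blast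
      then have "A \<in> closure W" "B \<in> closure W" using \<open>A \<in> core\<close> \<open>B \<in> core\<close> by (auto simp: core_def)
      then obtain S T where S: "\<And>m. S m \<in> W" "S \<longlonglongrightarrow> A" and T: "\<And>m. T m \<in> W" "T \<longlonglongrightarrow> B"
        by (metis closure_seq)
      have "(\<lambda>m. S m ** matrix_inv (T m)) \<longlonglongrightarrow> A ** matrix_inv B"
        by (intro tendsto_matrix_mult tendsto_matrix_inv S T AB)
      moreover have "S m ** matrix_inv (T m) \<in> V" for m using W S T by blast
      ultimately show ?thesis
        unfolding closure_sequential by (intro exI[of _ "\<lambda>m. S m ** matrix_inv (T m)"]) simp
    qed
    then show ?thesis using AB by (auto simp: core_def intro: invertible_mult invertible_matrix_inv)
  qed
  show "g ** A ** matrix_inv g \<in> core"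
    if A: "A \<in> core" and g: "invertible g" "\<And>i j. g $ i $ j \<in> \<rat>" for A g
  proof -
    have "g ** A ** matrix_inv g \<in> closure V" if V: "V \<in> \<V>" for V
    proof -
      have "g \<in> GL_set F" using g by (rule GL_rational)
      then obtain W where W: "W \<in> \<V>" "\<forall>x\<in>W. g ** x ** matrix_inv g \<in> V"
        using conjugation[OF V] by blast
      then have "A \<in> closure W" using A by (auto simp: core_def)
      then obtain S where S: "\<And>m. S m \<in> W" "S \<longlonglongrightarrow> A" by (metis closure_seq)
      have "(\<lambda>m. g ** S m ** matrix_inv g) \<longlonglongrightarrow> g ** A ** matrix_inv g"
        by (intro tendsto_matrix_mult tendsto_const S)
      moreover have "g ** S m ** matrix_inv g \<in> V" for m using W S by blast
      ultimately show ?thesis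
        unfolding closure_sequential by (intro exI[of _ "\<lambda>m. g ** S m ** matrix_inv g"]) simp
    qed
    then show ?thesis
      using A g by (auto simp: core_def intro!: invertible_mult invertible_matrix_inv)
  qed
qed

text \<open>The closure of \<open>W\<close> is contained in W W^-1 as far as GL(n,F) is concerned:
  if elements S_m of \<open>W\<close> tend to \<open>A\<close>, then A^-1 S_m tends to 1 and
  eventually lies in \<open>W\<close>, which is open in the usual topology, and A = S_m (A^-1
  S_m)^-1. So \<open>A\<close> lies in every neighbourhood, and separation applies.\<close>

lemma core_inter_GL:
  assumes A: "A \<in> core" "A \<in> GL_set F"
  shows "\<exists>c. A = mat c"
proof (rule separated[OF A(2)])
  fix V assume "V \<in> \<V>"
  then obtain W where W: "W \<in> \<V>" "\<forall>x\<in>W. \<forall>y\<in>W. x ** matrix_inv y \<in> V"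
    using division by blast
  have invA: "invertible A" using A by (simp add: core_def)
  obtain S where S: "\<And>m. S m \<in> W" "S \<longlonglongrightarrow> A"
    using A(1) W(1) by (auto simp: core_def intro: closure_seq)
  obtain T where T: "open T" "W = GL_set F \<inter> T"
    using open_nbhd[OF W(1)] by (auto simp: openin_open)
  have "(\<lambda>m. matrix_inv A ** S m) \<longlonglongrightarrow> matrix_inv A ** A"
    by (intro tendsto_intros S)
  then have "\<forall>\<^sub>F m in sequentially. matrix_inv A ** S m \<in> T"
    using one_mem[OF W(1)] T invA
    by (intro topological_tendstoD) (auto simp: matrix_inv_works)
  then obtain m where "matrix_inv A ** S m \<in> T"
    by (auto simp: eventually_sequentially)
  then have "matrix_inv A ** S m \<in> W"
    using S(1)[of m] T A(2) by (auto intro: GL_mult GL_inv)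
  then have "S m ** matrix_inv (matrix_inv A ** S m) \<in> V"
    using W S by blast
  moreover have "S m ** matrix_inv (matrix_inv A ** S m) = A"
    using nbhd_invertible[OF W(1) S(1)] invA
    by (simp add: matrix_inv_mult invertible_matrix_inv matrix_inv_involutive matrix_mul_assoc matrix_inv_works)
  ultimately show "A \<in> V" by simp
qed

lemma core_scalar:
  assumes "A \<in> core"
  shows "\<exists>c. A = mat c"
proof (rule ccontr)
  assume "\<not> ?thesis"
  then have A: "\<And>c. A \<noteq> mat c" by blast
  interpret closed_normal_GL core by (rule core_closed_normal)
  obtain p q :: 'n where pq: "p \<noteq> q" using nonscalar_distinct_indices[OF A] .
  have "mat 1 + single_mat p q 1 \<in> core" by (rule transvection_mem[OF assms A pq])
  moreover have "mat 1 + single_mat p q 1 \<in> GL_set F" by (intro GL_transvection pq F_closed)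
  ultimately show False using core_inter_GL transvection_nonscalar[OF pq] by (metis zero_neq_one)
qed

text \<open>If \<open>g\<close> is close to \<open>1\<close> in the coarse topology but some \<open>g E\<^sub>i\<^sub>j g\<inverse>\<close> is large, a small \<open>t\<close> brings
  \<open>g (1 + t E\<^sub>i\<^sub>j) g\<inverse>\<close> to bounded distance from \<open>1\<close> while it stays close to \<open>1\<close> in the coarse topology;
  an accumulation point is a nonscalar unipotent matrix in \<open>core\<close>.\<close>

lemma entry_products_bounded_on_nbhd:
  shows "\<exists>C. \<exists>V\<in>\<V>. \<forall>g\<in>V. \<forall>a i j b. \<bar>g $ a $ i * matrix_inv g $ j $ b\<bar> \<le> C"
proof (rule ccontr)
  assume neg: "\<not> ?thesis"
  have unbounded: "\<exists>g\<in>V. \<exists>a i j b. \<not> \<bar>g $ a $ i * matrix_inv g $ j $ b\<bar> \<le> C" if "V \<in> \<V>" for V C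
  proof (rule ccontr)
    assume "\<not> ?thesis"
    then have "\<forall>g\<in>V. \<forall>a i j b. \<bar>g $ a $ i * matrix_inv g $ j $ b\<bar> \<le> C" by simp
    with neg that show False by (meson bexI exI)
  qed
  \<comment> \<open>The conditions on \<open>Y\<close> are closed and survive in the limit: the
    lower bound excludes Y = 0, and a nonzero \<open>Y\<close> of square zero makes 1 + Y
    nonscalar.\<close>
  define Q where "Q = (\<lambda>Y. mat 1 + Y) ` ({Y :: real^'n^'n. \<forall>a b. \<bar>Y $ a $ b\<bar> \<le> 2}
    \<inter> ({Y. Y ** Y = 0} \<inter> {Y. 1 \<le> (\<Sum>a\<in>UNIV. \<Sum>b\<in>UNIV. \<bar>Y $ a $ b\<bar>)}))"
  have "compact Q"
    unfolding Q_def by (intro compact_continuous_image compact_Int_closed compact_entries_le closed_Int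
        closed_Collect_eq closed_Collect_le continuous_intros)
  moreover have "V \<inter> Q \<noteq> {}" if V: "V \<in> \<V>" for V
  proof -
    \<comment> \<open>Two divisions are needed to place g T^-1 g^-1 in \<open>V\<close>: one for g
      T^-1, one for the factor g^-1.\<close>
    obtain W' where W': "W' \<in> \<V>" "\<forall>x\<in>W'. \<forall>y\<in>W'. x ** matrix_inv y \<in> V"
      using division[OF V] by blast
    obtain W'' where W'': "W'' \<in> \<V>" "\<forall>x\<in>W''. \<forall>y\<in>W''. x ** matrix_inv y \<in> W'"
      using division[OF W'(1)] by blast
    obtain W where W: "W \<in> \<V>" "W \<subseteq> W' \<inter> W''"
      using directed[OF W'(1) W''(1)] by blast
    obtain T where T: "open T" "W = GL_set F \<inter> T"
      using open_nbhd[OF W(1)] by (auto simp: openin_open)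
    then obtain d where d: "d > 0" "ball (mat 1) d \<subseteq> T"
      using one_mem[OF W(1)] by (auto simp: open_contains_ball)
    have small: "mat 1 + single_mat i j t \<in> W" if "i \<noteq> j" "t \<in> F" "\<bar>t\<bar> < d" for i j t
    proof -
      have "(\<Sum>a\<in>UNIV. \<Sum>b\<in>UNIV. \<bar>single_mat i j t $ a $ b\<bar>) = (\<Sum>a\<in>UNIV. if a = i then \<bar>t\<bar> else 0)"
        by (intro sum.cong) (auto simp: if_distrib cong: if_cong)
      then have "norm (single_mat i j t) \<le> \<bar>t\<bar>"
        using norm_matrix_le[of "single_mat i j t"] by simp
      then have "mat 1 + single_mat i j t \<in> ball (mat 1) d"
        using that by (simp add: dist_norm)
      then show ?thesis using T d GL_transvection[OF that(1,2)] by blast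
    qed
    \<comment> \<open>With this bound, B < M and t M \<le> 2 force t < d, so the transvection with
      entry of size t lies in \<open>W\<close>.\<close>
    define B where "B = 2 / d"
    have "B > 0" using d by (simp add: B_def)
    obtain g where g: "g \<in> W" "\<exists>a i j b. \<not> \<bar>g $ a $ i * matrix_inv g $ j $ b\<bar> \<le> max 1 (max B (real CARD('n) * (B * B)))"
      using unbounded[OF W(1)] by blast
    define h where "h = matrix_inv g"
    have gi: "invertible g" using nbhd_invertible[OF W(1) g(1)] .
    have gh: "g ** h = mat 1" "h ** g = mat 1" using matrix_inv_works[OF gi] by (simp_all add: h_def)
    \<comment> \<open>The threshold used to choose \<open>g\<close> is the one of the entry
      estimate, so some product with i \<noteq> j must exceed \<open>B\<close>.\<close>
    have "\<exists>i j a b. i \<noteq> j \<and> B < \<bar>g $ a $ i * h $ j $ b\<bar>"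
      using entry_products_bounded[OF gh(2), of B] g(2) unfolding h_def by (metis not_le)
    then obtain i j a0 b0 where ij: "i \<noteq> j" "B < \<bar>g $ a0 $ i * h $ j $ b0\<bar>" by blast
    let ?R = "range (\<lambda>(a, b). \<bar>g $ a $ i * h $ j $ b\<bar>)"
    define M where "M = Max ?R"
    have "M \<in> ?R" unfolding M_def by (intro Max_in) auto
    then obtain a1 b1 where M: "M = \<bar>g $ a1 $ i * h $ j $ b1\<bar>" by auto
    have Mmax: "\<bar>g $ a $ i * h $ j $ b\<bar> \<le> M" for a b
      unfolding M_def by (intro Max_ge) (auto intro: image_eqI[of _ _ "(a, b)"])
    have "B < M" using ij Mmax[of a0 b0] by linarith
    then have "M > 0" using \<open>B > 0\<close> by linarith
    then obtain t where t: "t \<in> \<rat>" "0 < t" "1 \<le> t * M" "t * M \<le> 2"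
      using rational_normalization by blast
    have "t < d"
    proof -
      have "t * B < 2" using mult_strict_left_mono[OF \<open>B < M\<close> t(2)] t(4) by linarith
      then show ?thesis using d by (simp add: B_def field_simps)
    qed
    let ?E = "single_mat i j :: real \<Rightarrow> real^'n^'n"
    define Y where "Y = g ** ?E t ** h"
    \<comment> \<open>The sign is negative because \<open>division\<close> inverts its second
      argument.\<close>
    have "mat 1 + ?E (- t) \<in> W"
      using t \<open>t < d\<close> ij by (intro small F_rational) auto
    then have "g ** matrix_inv (mat 1 + ?E (- t)) \<in> W'" using W W'' g by blast
    then have "g ** matrix_inv (mat 1 + ?E (- t)) ** h \<in> V" using W W' g unfolding h_def by blast
    moreover have "?E (- t) = - ?E t" by (simp add: vec_eq_iff)
    then have "g ** matrix_inv (mat 1 + ?E (- t)) ** h = mat 1 + Y"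
      unfolding transvection_inverse(2)[OF ij(1)] using gh by (simp add: Y_def matrix_ring_simps)
    moreover have Yab: "Y $ a $ b = t * (g $ a $ i * h $ j $ b)" for a b
    proof -
      have "Y $ a $ b = (\<Sum>k\<in>UNIV. if k = j then t * (g $ a $ i * h $ j $ b) else 0)"
        unfolding Y_def mult_nth[of "g ** ?E t"] by (intro sum.cong) auto
      then show ?thesis by simp
    qed
    moreover have "Y ** Y = 0"
    proof -
      have "Y ** Y = g ** ?E t ** (h ** g) ** ?E t ** h"
        by (simp add: Y_def matrix_mul_assoc)
      also have "\<dots> = g ** (?E t ** ?E t) ** h"
        by (simp add: gh flip: matrix_mul_assoc)
      also have "\<dots> = 0"
        using single_square_zero[OF ij(1), of t t] by (simp add: vec_eq_iff mult_nth)
      finally show ?thesis .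
    qed
    moreover have "\<bar>Y $ a $ b\<bar> \<le> 2" for a b
    proof -
      have "t * \<bar>g $ a $ i * h $ j $ b\<bar> \<le> t * M" using t by (intro mult_left_mono Mmax) auto
      with t(4) have "t * \<bar>g $ a $ i * h $ j $ b\<bar> \<le> 2" by linarith
      then show ?thesis using t by (simp add: Yab abs_mult)
    qed
    moreover have "1 \<le> (\<Sum>a\<in>UNIV. \<Sum>b\<in>UNIV. \<bar>Y $ a $ b\<bar>)"
    proof -
      have "1 \<le> \<bar>Y $ a1 $ b1\<bar>" using t M by (simp add: Yab abs_mult)
      also have "\<dots> \<le> (\<Sum>b\<in>UNIV. \<bar>Y $ a1 $ b\<bar>)" by (rule member_le_sum) auto
      also have "\<dots> \<le> (\<Sum>a\<in>UNIV. \<Sum>b\<in>UNIV. \<bar>Y $ a $ b\<bar>)"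
        by (rule member_le_sum[of a1 _ "\<lambda>a. \<Sum>b\<in>UNIV. \<bar>Y $ a $ b\<bar>"]) (auto intro: sum_nonneg)
      finally show ?thesis .
    qed
    ultimately have "mat 1 + Y \<in> V \<inter> Q" unfolding Q_def by auto
    then show ?thesis by blast
  qed
  ultimately obtain x where x: "x \<in> Q" "\<And>V. V \<in> \<V> \<Longrightarrow> x \<in> closure V"
    using directed_accumulation[OF _ nonempty directed] by metis
  from x(1) obtain Y where Y: "x = mat 1 + Y" "Y ** Y = 0" "1 \<le> (\<Sum>a\<in>UNIV. \<Sum>b\<in>UNIV. \<bar>Y $ a $ b\<bar>)"
    by (auto simp: Q_def)
  have "x \<in> core" using x(2) square_zero_inverse(1)[OF Y(2)] Y(1) by (simp add: core_def)
  then obtain c where "mat 1 + Y = mat c" using core_scalar Y(1) by blast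
  then have "Y = mat c - mat 1" by (simp add: algebra_simps)
  also have "\<dots> = mat (c - 1)" by (simp add: vec_eq_iff mat_nth)
  finally have Ymat: "Y = mat (c - 1)" .
  have "(Y ** Y) $ a $ a = (c - 1) * (c - 1)" for a
    unfolding Ymat mult_nth by (simp add: mat_nth if_distrib [of "\<lambda>x. x * y" for y] cong: if_cong)
  then have "c = 1" using Y(2) by simp
  then show False using Y(3) by (simp add: Ymat mat_nth)
qed

text \<open>If no \<open>V\<close> were inside \<open>P\<close>, the sets \<open>V - P\<close> would
  be a directed family of nonempty sets, stable enough under scaling to meet a fixed compact subset
  of GL(n,\<real>). An accumulation point lies in \<open>core\<close>, so it is a scalar c. Dividing
  nearby elements by rationals close to c gives elements outside \<open>P\<close> that tend to 1,
  although \<open>P\<close> is a usual neighbourhood of 1.\<close>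

lemma nbhd_basis:
  assumes P: "openin (top_of_set (GL_set F)) P" "mat 1 \<in> P"
    and sat: "\<And>A c. A \<in> P \<Longrightarrow> c \<in> F \<Longrightarrow> c \<noteq> 0 \<Longrightarrow> c *\<^sub>R A \<in> P"
  shows "\<exists>V\<in>\<V>. V \<subseteq> P"
proof (rule ccontr)
  assume none: "\<not> ?thesis"
  obtain C V0 where V0: "V0 \<in> \<V>" "\<And>g a i j b. g \<in> V0 \<Longrightarrow> \<bar>g $ a $ i * matrix_inv g $ j $ b\<bar> \<le> C"
    using entry_products_bounded_on_nbhd by blast
  define Q where "Q = {A :: real^'n^'n. invertible A \<and> (\<forall>i j. \<bar>A $ i $ j\<bar> \<le> 2)
    \<and> (\<forall>i j. \<bar>matrix_inv A $ i $ j\<bar> \<le> C)}"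
  have meets: "(V - P) \<inter> Q \<noteq> {}" if V: "V \<in> \<V>" for V
  proof -
    obtain U where U: "U \<in> \<V>" "U \<subseteq> V \<inter> V0" using directed[OF V V0(1)] by blast
    then obtain g where g: "g \<in> U" "g \<notin> P" using none by blast
    have gi: "invertible g" using nbhd_invertible[OF U(1) g(1)] .
    let ?R = "range (\<lambda>(a, i). \<bar>g $ a $ i\<bar>)"
    define M where "M = Max ?R"
    have "M \<in> ?R" unfolding M_def by (intro Max_in) auto
    then obtain a1 i1 where M: "M = \<bar>g $ a1 $ i1\<bar>" by auto
    have Mmax: "\<bar>g $ a $ i\<bar> \<le> M" for a i
      unfolding M_def by (intro Max_ge) (auto intro: image_eqI[of _ _ "(a, i)"])
    have "M > 0"
    proof (rule ccontr)
      assume "\<not> M > 0"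
      then have "g $ a $ i = 0" for a i using Mmax[of a i] by simp
      then have "(g ** matrix_inv g) $ a1 $ a1 = 0" by (simp add: mult_nth)
      then show False using matrix_inv_works(1)[OF gi] by (simp add: mat_nth)
    qed
    then obtain t where t: "t \<in> \<rat>" "0 < t" "1 \<le> t * M" "t * M \<le> 2"
      using rational_normalization by blast
    have tF: "t \<in> F" "t \<noteq> 0" using t F_rational by auto
    have "t *\<^sub>R g \<in> V" using U g saturated[OF U(1) g(1) tF] by blast
    moreover have "t *\<^sub>R g \<notin> P"
      using sat[of "t *\<^sub>R g" "inverse t"] g(2) tF F_closed(6) by auto
    moreover have "\<bar>(t *\<^sub>R g) $ i $ j\<bar> \<le> 2" for i j
    proof -
      have "t * \<bar>g $ i $ j\<bar> \<le> t * M" using t by (intro mult_left_mono Mmax) auto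
      with t(4) have "t * \<bar>g $ i $ j\<bar> \<le> 2" by linarith
      then show ?thesis using t by (simp add: abs_mult)
    qed
    moreover have "\<bar>matrix_inv (t *\<^sub>R g) $ i $ j\<bar> \<le> C" for i j
    proof -
      have h: "matrix_inv (t *\<^sub>R g) $ i $ j = inverse t * matrix_inv g $ i $ j"
        using scalar_inverse(2)[OF tF(2) gi] by simp
      \<comment> \<open>The factor t M \<ge> 1 turns an entry of the inverse of t g into a product
        of an entry of \<open>g\<close> and one of its inverse; such products are bounded by
        \<open>C\<close> on \<open>V0\<close>.\<close>
      have "\<bar>matrix_inv (t *\<^sub>R g) $ i $ j\<bar> \<le> (t * M) * \<bar>matrix_inv (t *\<^sub>R g) $ i $ j\<bar>"
        using mult_right_mono[OF t(3), of "\<bar>matrix_inv (t *\<^sub>R g) $ i $ j\<bar>"] by simp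
      also have "\<dots> = \<bar>g $ a1 $ i1 * matrix_inv g $ i $ j\<bar>"
        using t by (simp add: h M abs_mult)
      also have "\<dots> \<le> C" using V0(2) U g by blast
      finally show ?thesis .
    qed
    ultimately have "t *\<^sub>R g \<in> (V - P) \<inter> Q"
      using scalar_inverse(1)[OF tF(2) gi] by (simp add: Q_def)
    then show ?thesis by blast
  qed
  let ?\<W> = "(\<lambda>V. V - P) ` \<V>"
  obtain x where x: "x \<in> Q" "\<And>V. V \<in> ?\<W> \<Longrightarrow> x \<in> closure V"
  proof (rule directed_accumulation[of Q ?\<W>])
    show "compact Q" unfolding Q_def by (rule compact_invertible_entries_le)
    show "?\<W> \<noteq> {}" using nonempty by simp
    show "V \<inter> Q \<noteq> {}" if "V \<in> ?\<W>" for V using that meets by (elim imageE) simp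
    show "\<exists>U\<in>?\<W>. U \<subseteq> V \<inter> W" if VW: "V \<in> ?\<W>" "W \<in> ?\<W>" for V W
    proof -
      obtain V' where V': "V' \<in> \<V>" "V = V' - P" using VW(1) by (elim imageE)
      obtain W' where W': "W' \<in> \<V>" "W = W' - P" using VW(2) by (elim imageE)
      obtain U where "U \<in> \<V>" "U \<subseteq> V' \<inter> W'" using directed[OF V'(1) W'(1)] by (elim bexE)
      then show ?thesis using V' W' by (intro bexI[of _ "U - P"]) auto
    qed
  qed (rule that)
  have cl: "x \<in> closure (V - P)" if "V \<in> \<V>" for V using x(2) that by blast
  have "x \<in> closure V" if "V \<in> \<V>" for V
    using cl[OF that] closure_mono[of "V - P" V] by blast
  then have "x \<in> core" using x(1) by (simp add: core_def Q_def)
  then obtain c where c: "x = mat c" using core_scalar by blast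
  have "c \<noteq> 0"
  proof
    assume "c = 0"
    then have "(x ** matrix_inv x) $ i $ i = 0" for i by (simp add: c mult_nth mat_nth)
    moreover have "invertible x" using x(1) by (simp add: Q_def)
    ultimately show False by (simp add: matrix_inv_works mat_nth)
  qed
  obtain S where S: "\<And>m. S m \<in> V0 - P" "S \<longlonglongrightarrow> mat c"
    using cl[OF V0(1)] c closure_seq by metis
  \<comment> \<open>The limit c may lie outside \<open>F\<close>, so the rescaling uses rational
    approximations of c.\<close>
  obtain q where q: "\<And>m::nat. q m \<in> \<rat>" "q \<longlonglongrightarrow> c"
    using Rats_closure_real closure_sequential[of c \<rat>] by auto
  have "(\<lambda>m. inverse (q m) *\<^sub>R S m) \<longlonglongrightarrow> inverse c *\<^sub>R mat c"
    by (intro tendsto_intros q S \<open>c \<noteq> 0\<close>)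
  also have "inverse c *\<^sub>R mat c = (mat 1 :: real^'n^'n)"
    using \<open>c \<noteq> 0\<close> by (simp add: vec_eq_iff mat_nth)
  finally have lim: "(\<lambda>m. inverse (q m) *\<^sub>R S m) \<longlonglongrightarrow> mat 1" .
  obtain T where T: "open T" "P = GL_set F \<inter> T" using P(1) by (auto simp: openin_open)
  have "\<forall>\<^sub>F m in sequentially. inverse (q m) *\<^sub>R S m \<in> T \<and> q m \<noteq> 0"
    using topological_tendstoD[OF lim T(1)] P(2) T(2) tendsto_imp_eventually_ne[OF q(2) \<open>c \<noteq> 0\<close>]
    by (auto intro: eventually_conj)
  then obtain m where m: "inverse (q m) *\<^sub>R S m \<in> T" "q m \<noteq> 0"
    by (auto simp: eventually_sequentially)
  have qF: "q m \<in> F" using q F_rational by blast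
  have "S m \<in> GL_set F" using S(1)[of m] subset_GL[OF V0(1)] by blast
  then have "inverse (q m) *\<^sub>R S m \<in> P"
    unfolding T(2) using m qF by (auto intro: GL_scaleR F_closed)
  then have "q m *\<^sub>R inverse (q m) *\<^sub>R S m \<in> P" by (rule sat[OF _ qF m(2)])
  then show False using S(1)[of m] m by simp
qed

end

section \<open>Quotients of topological groups\<close>

locale hausdorff_group = group G for G (structure) +
  fixes T :: "'a topology"
  assumes topspace: "topspace T = carrier G"
    and mult_cont: "continuous_map (prod_topology T T) T (\<lambda>(x, y). x \<otimes> y)"
    and inv_cont: "continuous_map T T (\<lambda>x. inv x)"
    and hausdorff: "Hausdorff_space T"

lemma hausdorff_group_iff: "hausdorff_topological_group G T \<longleftrightarrow> hausdorff_group G T"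
  by (auto simp: hausdorff_topological_group_def hausdorff_group_def hausdorff_group_axioms_def)

context hausdorff_group
begin

lemma mult_cont':
  assumes "continuous_map Y T f" "continuous_map Y T g"
  shows "continuous_map Y T (\<lambda>x. f x \<otimes> g x)"
  using continuous_map_compose[OF continuous_map_pairedI[OF assms] mult_cont] by (simp add: o_def)

lemma inv_cont': "continuous_map Y T f \<Longrightarrow> continuous_map Y T (\<lambda>x. inv (f x))"
  using continuous_map_compose[OF _ inv_cont, of Y f] by (simp add: o_def)

lemma const_cont: "a \<in> carrier G \<Longrightarrow> continuous_map Y T (\<lambda>x. a)"
  by (simp add: topspace)

lemma division_nbhd:
  assumes U: "openin T U" "\<one> \<in> U"
  obtains W where "openin T W" "\<one> \<in> W" "\<And>x y. x \<in> W \<Longrightarrow> y \<in> W \<Longrightarrow> x \<otimes> inv y \<in> U"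
proof -
  have "continuous_map (prod_topology T T) T (\<lambda>p. fst p \<otimes> inv (snd p))"
    by (intro mult_cont' inv_cont' continuous_map_fst continuous_map_snd)
  then have D: "openin (prod_topology T T) {p \<in> topspace (prod_topology T T). fst p \<otimes> inv (snd p) \<in> U}"
    (is "openin _ ?D")
    by (rule openin_continuous_map_preimage[OF _ U(1)])
  have one: "(\<one>, \<one>) \<in> ?D"
    using U by (simp add: topspace)
  obtain A B where AB: "openin T A" "openin T B" "\<one> \<in> A" "\<one> \<in> B" "A \<times> B \<subseteq> ?D"
    using openin_prod_topology_alt[THEN iffD1, rule_format, OF D one] by (elim exE conjE)
  show ?thesis
    by (rule that[of "A \<inter> B"]) (use AB in \<open>auto intro: openin_Int\<close>)
qed

lemma open_subset: "openin T U \<Longrightarrow> U \<subseteq> carrier G"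
  using openin_subset topspace by blast

lemma open_right_translate:
  assumes "openin T U" "a \<in> carrier G"
  shows "openin T {x \<in> carrier G. x \<otimes> a \<in> U}"
proof -
  have "continuous_map T T (\<lambda>x. x \<otimes> a)"
    by (intro mult_cont' const_cont assms continuous_map_id[unfolded id_def])
  from openin_continuous_map_preimage[OF this assms(1)] show ?thesis by (simp add: topspace)
qed

lemma open_left_translate:
  assumes "openin T U" "a \<in> carrier G"
  shows "openin T {x \<in> carrier G. a \<otimes> x \<in> U}"
proof -
  have "continuous_map T T (\<lambda>x. a \<otimes> x)"
    by (intro mult_cont' const_cont assms continuous_map_id[unfolded id_def])
  from openin_continuous_map_preimage[OF this assms(1)] show ?thesis by (simp add: topspace)
qed

lemma open_conjugate:
  assumes "openin T U" "a \<in> carrier G"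
  shows "openin T {x \<in> carrier G. a \<otimes> x \<otimes> inv a \<in> U}"
proof -
  have "continuous_map T T (\<lambda>x. a \<otimes> x \<otimes> inv a)"
    by (intro mult_cont' const_cont assms inv_closed continuous_map_id[unfolded id_def])
  from openin_continuous_map_preimage[OF this assms(1)] show ?thesis by (simp add: topspace)
qed

lemma closed_center: "closedin T (group_center G)"
proof -
  have "closedin T {x \<in> topspace T. x \<otimes> g = g \<otimes> x}" if "g \<in> carrier G" for g
    by (intro closedin_continuous_maps_eq[OF hausdorff] mult_cont' const_cont that
        continuous_map_id[unfolded id_def])
  then have "closedin T (topspace T \<inter> (\<Inter>g\<in>carrier G. {x \<in> topspace T. x \<otimes> g = g \<otimes> x}))"
    by (intro closedin_Int closedin_INT) auto
  moreover have "topspace T \<inter> (\<Inter>g\<in>carrier G. {x \<in> topspace T. x \<otimes> g = g \<otimes> x}) = group_center G"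
    by (auto simp: group_center_def topspace)
  ultimately show ?thesis by simp
qed

end

lemma (in group) normal_group_center: "group_center G \<lhd> G"
proof -
  have inv_comm: "inv z \<otimes> g = g \<otimes> inv z"
    if "z \<in> carrier G" "g \<in> carrier G" "z \<otimes> g = g \<otimes> z" for z g
  proof -
    have "inv z \<otimes> g = inv z \<otimes> (g \<otimes> z) \<otimes> inv z"
      using that by (simp add: m_assoc)
    also have "\<dots> = inv z \<otimes> (z \<otimes> g) \<otimes> inv z"
      by (simp only: that(3))
    also have "\<dots> = g \<otimes> inv z"
      using that(1,2) by (simp add: m_assoc[symmetric])
    finally show ?thesis .
  qed
  have "subgroup (group_center G) G"
  proof
    show "group_center G \<subseteq> carrier G" by (auto simp: group_center_def)
    show "x \<otimes> y \<in> group_center G" if "x \<in> group_center G" "y \<in> group_center G" for x y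
    proof -
      have xy: "x \<in> carrier G" "y \<in> carrier G" using that by (auto simp: group_center_def)
      have "x \<otimes> y \<otimes> g = g \<otimes> (x \<otimes> y)" if g: "g \<in> carrier G" for g
      proof -
        have "x \<otimes> y \<otimes> g = x \<otimes> (y \<otimes> g)" using xy g by (simp add: m_assoc)
        also have "y \<otimes> g = g \<otimes> y" using \<open>y \<in> group_center G\<close> g by (simp add: group_center_def)
        also have "x \<otimes> (g \<otimes> y) = x \<otimes> g \<otimes> y" using xy g by (simp add: m_assoc)
        also have "x \<otimes> g = g \<otimes> x" using \<open>x \<in> group_center G\<close> g by (simp add: group_center_def)
        finally show ?thesis using xy g by (simp add: m_assoc)
      qed
      then show ?thesis using xy by (simp add: group_center_def)
    qed
    show "\<one> \<in> group_center G" by (auto simp: group_center_def)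
    show "inv x \<in> group_center G" if "x \<in> group_center G" for x
      using that by (auto simp: group_center_def inv_comm)
  qed
  moreover have "x \<otimes> h \<otimes> inv x \<in> group_center G" if "x \<in> carrier G" "h \<in> group_center G" for x h
  proof -
    have "h \<in> carrier G" "x \<otimes> h = h \<otimes> x" using that by (auto simp: group_center_def)
    then have "x \<otimes> h \<otimes> inv x = h" using that by (simp add: m_assoc)
    then show ?thesis using that by simp
  qed
  ultimately show ?thesis by (simp add: normal_inv_iff)
qed

text \<open>The projection is open, because the saturation of an open set is a union of its
  translates by \<open>N\<close>. For the Hausdorff property, if x y^-1 is not in the closed set
  \<open>N\<close>, the same holds for all pairs in a box A \<times> B around (x, y), and the images
  of A and B are disjoint open sets.\<close>

lemma quotient_hausdorff_group:
  assumes "hausdorff_group G T" "N \<lhd> G" "closedin T N"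
  shows "hausdorff_group (G Mod N) (quotient_group_topology G T N)"
proof -
  interpret hausdorff_group G T by fact
  interpret N: normal N G by fact
  let ?Q = "quotient_group_topology G T N" and ?p = "\<lambda>x. N #>\<^bsub>G\<^esub> x"
  have quot: "quotient_map T ?Q ?p"
    by (rule quotient_map_quotient_group_topology[OF topspace])
  have topQ: "topspace ?Q = carrier (G Mod N)"
    using quotient_imp_surjective_map[OF quot] by (simp add: topspace carrier_FactGroup)
  have p_eq: "?p x = ?p y \<longleftrightarrow> x \<otimes>\<^bsub>G\<^esub> inv\<^bsub>G\<^esub> y \<in> N" if "x \<in> carrier G" "y \<in> carrier G" for x y
  proof
    assume "?p x = ?p y"
    then have "x \<in> ?p y" using rcos_self[OF that(1) N.is_subgroup] by simp
    then show "x \<otimes>\<^bsub>G\<^esub> inv\<^bsub>G\<^esub> y \<in> N"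
      using that N.subset by (auto simp: r_coset_def m_assoc)
  next
    assume "x \<otimes>\<^bsub>G\<^esub> inv\<^bsub>G\<^esub> y \<in> N"
    then have "x \<in> ?p y"
      using that by (auto simp: r_coset_def m_assoc intro!: bexI[of _ "x \<otimes>\<^bsub>G\<^esub> inv\<^bsub>G\<^esub> y"])
    then show "?p x = ?p y" using repr_independence[OF _ that(2) N.is_subgroup] by simp
  qed
  have p_mult: "?p x <#>\<^bsub>G\<^esub> ?p y = ?p (x \<otimes>\<^bsub>G\<^esub> y)" if "x \<in> carrier G" "y \<in> carrier G" for x y
    using N.rcos_sum that by simp
  have op: "openin ?Q (?p ` U)" if U: "openin T U" for U
  proof -
    have "{x \<in> carrier G. ?p x \<in> ?p ` U} = (\<Union>n\<in>N. {x \<in> carrier G. n \<otimes>\<^bsub>G\<^esub> x \<in> U})"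
    proof (intro equalityI subsetI)
      fix x assume "x \<in> {x \<in> carrier G. ?p x \<in> ?p ` U}"
      then obtain u where u: "x \<in> carrier G" "u \<in> U" "?p u = ?p x" by auto
      have "u \<in> carrier G" using u open_subset[OF U] by blast
      then have "u \<otimes>\<^bsub>G\<^esub> inv\<^bsub>G\<^esub> x \<in> N" "u \<otimes>\<^bsub>G\<^esub> inv\<^bsub>G\<^esub> x \<otimes>\<^bsub>G\<^esub> x \<in> U"
        using u p_eq[of u x] by (simp_all add: m_assoc)
      then show "x \<in> (\<Union>n\<in>N. {x \<in> carrier G. n \<otimes>\<^bsub>G\<^esub> x \<in> U})" using u by blast
    next
      fix x assume "x \<in> (\<Union>n\<in>N. {x \<in> carrier G. n \<otimes>\<^bsub>G\<^esub> x \<in> U})"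
      then obtain n where n: "n \<in> N" "x \<in> carrier G" "n \<otimes>\<^bsub>G\<^esub> x \<in> U" by blast
      then have "?p (n \<otimes>\<^bsub>G\<^esub> x) = ?p x"
        using N.subset by (subst p_eq) (auto simp: m_assoc)
      then show "x \<in> {x \<in> carrier G. ?p x \<in> ?p ` U}" using n by (auto intro: image_eqI[OF sym])
    qed
    moreover have "openin T (\<Union>n\<in>N. {x \<in> carrier G. n \<otimes>\<^bsub>G\<^esub> x \<in> U})"
      using open_left_translate[OF U] N.subset by (intro openin_Union) auto
    ultimately show ?thesis
      using open_subset[OF U] by (auto simp: openin_quotient_group_topology carrier_FactGroup)
  qed
  \<comment> \<open>A product of quotient maps need not be a quotient map; a product of open ones is
    open, and this lets multiplication descend to the quotient.\<close>
  have open_quot2: "quotient_map (prod_topology T T) (prod_topology ?Q ?Q) (\<lambda>(x, y). (?p x, ?p y))"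
  proof (rule continuous_open_imp_quotient_map)
    show "continuous_map (prod_topology T T) (prod_topology ?Q ?Q) (\<lambda>(x, y). (?p x, ?p y))"
      using quotient_imp_continuous_map[OF quot]
      by (simp add: continuous_map_prod_top)
    show "open_map (prod_topology T T) (prod_topology ?Q ?Q) (\<lambda>(x, y). (?p x, ?p y))"
      unfolding open_map_def
    proof (intro allI impI)
      fix U assume U: "openin (prod_topology T T) U"
      show "openin (prod_topology ?Q ?Q) ((\<lambda>(x, y). (?p x, ?p y)) ` U)"
        unfolding openin_prod_topology_alt
      proof (intro allI impI)
        fix a b assume "(a, b) \<in> (\<lambda>(x, y). (?p x, ?p y)) ` U"
        then obtain x y where xy: "(x, y) \<in> U" "a = ?p x" "b = ?p y" by auto
        obtain A B where AB: "openin T A" "openin T B" "x \<in> A" "y \<in> B" "A \<times> B \<subseteq> U"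
          using openin_prod_topology_alt[THEN iffD1, rule_format, OF U xy(1)] by (elim exE conjE)
        then have "?p ` A \<times> ?p ` B \<subseteq> (\<lambda>(x, y). (?p x, ?p y)) ` U" by auto
        with AB show "\<exists>A B. openin ?Q A \<and> openin ?Q B \<and> a \<in> A \<and> b \<in> B
            \<and> A \<times> B \<subseteq> (\<lambda>(x, y). (?p x, ?p y)) ` U"
          unfolding xy(2,3) by (intro exI[of _ "?p ` A"] exI[of _ "?p ` B"] conjI op imageI)
      qed
    qed
    show "(\<lambda>(x, y). (?p x, ?p y)) ` topspace (prod_topology T T) = topspace (prod_topology ?Q ?Q)"
      by (auto simp: topQ topspace carrier_FactGroup)
  qed
  show ?thesis
  proof (intro hausdorff_group.intro hausdorff_group_axioms.intro)
    show "group (G Mod N)" by (rule N.factorgroup_is_group)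
    show "topspace ?Q = carrier (G Mod N)" by (rule topQ)
    have "continuous_map (prod_topology T T) ?Q (?p \<circ> (\<lambda>(x, y). x \<otimes>\<^bsub>G\<^esub> y))"
      by (rule continuous_map_compose[OF mult_cont quotient_imp_continuous_map[OF quot]])
    then have "continuous_map (prod_topology T T) ?Q
        ((\<lambda>(x, y). x \<otimes>\<^bsub>G Mod N\<^esub> y) \<circ> (\<lambda>(x, y). (?p x, ?p y)))"
      by (rule continuous_map_eq) (auto simp: topspace p_mult)
    then show "continuous_map (prod_topology ?Q ?Q) ?Q (\<lambda>(x, y). x \<otimes>\<^bsub>G Mod N\<^esub> y)"
      by (rule continuous_compose_quotient_map[OF open_quot2])
    have "continuous_map T ?Q (?p \<circ> (\<lambda>x. inv\<^bsub>G\<^esub> x))"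
      by (rule continuous_map_compose[OF inv_cont quotient_imp_continuous_map[OF quot]])
    then have "continuous_map T ?Q ((\<lambda>x. inv\<^bsub>G Mod N\<^esub> x) \<circ> ?p)"
      by (rule continuous_map_eq)
        (auto simp: topspace carrier_FactGroup N.inv_FactGroup N.rcos_inv)
    then show "continuous_map ?Q ?Q (\<lambda>x. inv\<^bsub>G Mod N\<^esub> x)"
      by (rule continuous_compose_quotient_map[OF quot])
    show "Hausdorff_space ?Q"
      unfolding Hausdorff_space_def
    proof (intro allI impI)
      fix a b assume ab: "a \<in> topspace ?Q \<and> b \<in> topspace ?Q \<and> a \<noteq> b"
      then obtain x y where xy: "x \<in> carrier G" "y \<in> carrier G" "a = ?p x" "b = ?p y"
        by (auto simp: topQ carrier_FactGroup)
      have "continuous_map (prod_topology T T) T (\<lambda>p. fst p \<otimes>\<^bsub>G\<^esub> inv\<^bsub>G\<^esub> (snd p))"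
        by (intro mult_cont' inv_cont' continuous_map_fst continuous_map_snd)
      then have D: "openin (prod_topology T T)
          {p \<in> topspace (prod_topology T T). fst p \<otimes>\<^bsub>G\<^esub> inv\<^bsub>G\<^esub> (snd p) \<in> topspace T - N}"
        (is "openin _ ?D")
        using assms(3) by (intro openin_continuous_map_preimage) auto
      have xyD: "(x, y) \<in> ?D"
        using xy ab p_eq[of x y] by (simp add: topspace)
      obtain A B where AB: "openin T A" "openin T B" "x \<in> A" "y \<in> B" "A \<times> B \<subseteq> ?D"
        using openin_prod_topology_alt[THEN iffD1, rule_format, OF D xyD] by (elim exE conjE)
      have "disjnt (?p ` A) (?p ` B)"
      proof -
        have "?p u \<noteq> ?p v" if "u \<in> A" "v \<in> B" for u v
        proof -
          have "(u, v) \<in> A \<times> B" using that by simp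
          then have "u \<otimes>\<^bsub>G\<^esub> inv\<^bsub>G\<^esub> v \<notin> N" "u \<in> carrier G" "v \<in> carrier G"
            using AB(5) by (auto simp: topspace)
          then show ?thesis by (simp add: p_eq)
        qed
        then show ?thesis by (auto simp: disjnt_iff)
      qed
      then show "\<exists>U V. openin ?Q U \<and> openin ?Q V \<and> a \<in> U \<and> b \<in> V \<and> disjnt U V"
        unfolding xy(3,4) using AB by (intro exI[of _ "?p ` A"] exI[of _ "?p ` B"] conjI op imageI)
    qed
  qed
qed

section \<open>The groups GL and PGL\<close>

context real_subfield
begin

lemma GL_group_simps:
  "carrier (GL_group F :: (real^'n^'n) monoid) = GL_set F"
  "x \<otimes>\<^bsub>GL_group F\<^esub> y = x ** (y :: real^'n^'n)"
  "\<one>\<^bsub>GL_group F\<^esub> = (mat 1 :: real^'n^'n)"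
proof -
  show "carrier (GL_group F :: (real^'n^'n) monoid) = GL_set F"
  proof (intro equalityI subsetI)
    fix A :: "real^'n^'n" assume "A \<in> carrier (GL_group F)"
    then show "A \<in> GL_set F"
      by (auto simp: GL_group_def units_of_def Units_def matrix_monoid_def GL_set_def invertible_def)
  next
    fix A :: "real^'n^'n" assume A: "A \<in> GL_set F"
    have "matrix_inv A \<in> GL_set F" using A by (rule GL_inv)
    then show "A \<in> carrier (GL_group F)"
      using A matrix_inv_works[of A]
      by (auto simp: GL_group_def units_of_def Units_def matrix_monoid_def GL_set_def)
  qed
qed (simp_all add: GL_group_def units_of_def matrix_monoid_def)

lemma one_GL: "mat 1 \<in> GL_set F"
  by (auto simp: GL_set_def mat_nth intro: F_closed)

lemma group_GL: "group (GL_group F :: (real^'n^'n) monoid)"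
proof (rule groupI)
  fix x :: "real^'n^'n" assume "x \<in> carrier (GL_group F)"
  then have x: "x \<in> GL_set F" by (simp add: GL_group_simps)
  then have "matrix_inv x ** x = mat 1" by (simp add: GL_set_def matrix_inv_works)
  with GL_inv[OF x] show "\<exists>y\<in>carrier (GL_group F). y \<otimes>\<^bsub>GL_group F\<^esub> x = \<one>\<^bsub>GL_group F\<^esub>"
    by (auto simp: GL_group_simps)
qed (auto simp: GL_group_simps GL_mult one_GL matrix_mul_assoc)

lemma inv_GL: "x \<in> GL_set F \<Longrightarrow> inv\<^bsub>GL_group F\<^esub> x = matrix_inv (x :: real^'n^'n)"
  using GL_inv[of x] matrix_inv_works[of x]
  by (intro group.inv_equality[OF group_GL]) (simp_all add: GL_group_simps, simp add: GL_set_def)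

lemma hausdorff_group_GL: "hausdorff_group (GL_group F :: (real^'n^'n) monoid) (GL_topology F)"
proof (intro hausdorff_group.intro hausdorff_group_axioms.intro)
  let ?G = "GL_group F :: (real^'n^'n) monoid"
  have T: "GL_topology F = top_of_set (GL_set F :: (real^'n^'n) set)"
    by (simp add: GL_topology_def GL_group_simps)
  show "group ?G" by (rule group_GL)
  show "topspace (GL_topology F) = carrier ?G" by (simp add: GL_topology_def)
  have "continuous_on (GL_set F \<times> GL_set F) (\<lambda>(x, y). x ** (y :: real^'n^'n))"
    unfolding case_prod_unfold by (intro continuous_intros)
  then show "continuous_map (prod_topology (GL_topology F) (GL_topology F)) (GL_topology F) (\<lambda>(x, y). x \<otimes>\<^bsub>?G\<^esub> y)"
    by (auto simp: T GL_group_simps GL_mult)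
  have "continuous_on (GL_set F) (matrix_inv :: real^'n^'n \<Rightarrow> _)"
    unfolding continuous_on_def
    by (intro ballI tendsto_matrix_inv) (auto simp: GL_set_def)
  then have "continuous_map (GL_topology F) (GL_topology F) (matrix_inv :: real^'n^'n \<Rightarrow> _)"
    by (auto simp: T GL_inv)
  then show "continuous_map (GL_topology F) (GL_topology F) (\<lambda>x. inv\<^bsub>?G\<^esub> x)"
    by (rule continuous_map_eq) (simp add: T inv_GL)
  show "Hausdorff_space (GL_topology F :: (real^'n^'n) topology)"
    by (simp add: T Hausdorff_space_subtopology)
qed

section \<open>Scalar matrices, closed normal subgroups and minimality\<close>

lemma mat_GL: "c \<in> F \<Longrightarrow> c \<noteq> 0 \<Longrightarrow> mat c \<in> GL_set F"
  using GL_scaleR[OF one_GL, of c] by (simp flip: mat_eq_scaleR(2))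

lemma mat_center: "c \<in> F \<Longrightarrow> c \<noteq> 0 \<Longrightarrow> mat c \<in> group_center (GL_group F :: (real^'n^'n) monoid)"
  by (auto simp: group_center_def GL_group_simps mat_GL mat_eq_scaleR)

lemma closed_normal_dichotomy:
  fixes H :: "(real^'n^'n) set"
  assumes odd: "odd CARD('n)" and HG: "H \<subseteq> GL_set F"
    and relclosed: "closedin (top_of_set (GL_set F)) H"
    and scalars: "\<And>c. c \<in> F \<Longrightarrow> c \<noteq> 0 \<Longrightarrow> mat c \<in> H"
    and div: "\<And>x y. x \<in> H \<Longrightarrow> y \<in> H \<Longrightarrow> x ** matrix_inv y \<in> H"
    and conj: "\<And>g x. g \<in> GL_set F \<Longrightarrow> x \<in> H \<Longrightarrow> g ** x ** matrix_inv g \<in> H"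
  shows "(\<forall>A\<in>H. \<exists>c. A = mat c) \<or> H = GL_set F"
proof (cases "\<forall>A\<in>H. \<exists>c. A = mat c")
  case False
  then obtain A where A: "A \<in> H" "\<And>c. A \<noteq> mat c" by blast
  define K where "K = closure H \<inter> {x. invertible x}"
  have inv: "invertible x" if "x \<in> H" for x using that HG by (auto simp: GL_set_def)
  have HK: "H \<subseteq> K" using closure_subset inv by (auto simp: K_def)
  interpret closed_normal_GL K
  proof
    show "invertible x" if "x \<in> K" for x using that by (simp add: K_def)
    show "x \<in> K" if "x \<in> closure K" "invertible x" for x
      using that closure_mono[of K "closure H"] by (auto simp: K_def)
    show "x ** matrix_inv y \<in> K" if "x \<in> K" "y \<in> K" for x y
    proof -
      have xy: "invertible x" "invertible y" using that by (auto simp: K_def)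
      have "x \<in> closure H" "y \<in> closure H" using that by (auto simp: K_def)
      then obtain S R where S: "\<And>m. S m \<in> H" "S \<longlonglongrightarrow> x" and R: "\<And>m. R m \<in> H" "R \<longlonglongrightarrow> y"
        by (metis closure_seq)
      have "(\<lambda>m. S m ** matrix_inv (R m)) \<longlonglongrightarrow> x ** matrix_inv y"
        by (intro tendsto_matrix_mult tendsto_matrix_inv S R xy)
      then have "x ** matrix_inv y \<in> closure H"
        unfolding closure_sequential using div[OF S(1) R(1)]
        by (intro exI[of _ "\<lambda>m. S m ** matrix_inv (R m)"]) simp
      then show ?thesis using xy by (simp add: K_def invertible_mult invertible_matrix_inv)
    qed
    show "g ** x ** matrix_inv g \<in> K"
      if x: "x \<in> K" and g: "invertible g" "\<And>i j. g $ i $ j \<in> \<rat>" for x g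
    proof -
      have "invertible x" "x \<in> closure H" using x by (auto simp: K_def)
      then obtain S where S: "\<And>m. S m \<in> H" "S \<longlonglongrightarrow> x"
        by (metis closure_seq)
      have "(\<lambda>m. g ** S m ** matrix_inv g) \<longlonglongrightarrow> g ** x ** matrix_inv g"
        by (intro tendsto_matrix_mult tendsto_const S)
      then have "g ** x ** matrix_inv g \<in> closure H"
        unfolding closure_sequential using conj[OF GL_rational[OF g] S(1)]
        by (intro exI[of _ "\<lambda>m. g ** S m ** matrix_inv g"]) simp
      then show ?thesis using \<open>invertible x\<close> g(1) by (simp add: K_def invertible_mult invertible_matrix_inv)
    qed
  qed
  have trans: "mat 1 + single_mat p q c \<in> K" if "p \<noteq> q" for p q c
    using HK A that by (intro transvection_mem[of A]) auto
  \<comment> \<open>Only scalars from \<open>F\<close> are given in \<open>H\<close>; real ones are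
    limits of nonzero rational ones.\<close>
  have scalarK: "mat c \<in> K" if c: "c \<noteq> 0" for c
  proof -
    obtain q where q: "\<And>m::nat. q m \<in> \<rat>" "q \<longlonglongrightarrow> c"
      using Rats_closure_real closure_sequential[of c \<rat>] by auto
    have "\<forall>\<^sub>F m in sequentially. q m \<noteq> 0"
      by (rule tendsto_imp_eventually_ne[OF q(2) c])
    then obtain M where M: "\<And>m. m \<ge> M \<Longrightarrow> q m \<noteq> 0" by (auto simp: eventually_sequentially)
    have "(\<lambda>m. q (m + M) *\<^sub>R mat 1) \<longlonglongrightarrow> c *\<^sub>R (mat 1 :: real^'n^'n)"
      by (intro tendsto_scaleR tendsto_const LIMSEQ_ignore_initial_segment q)
    then have "(\<lambda>m. mat (q (m + M))) \<longlonglongrightarrow> (mat c :: real^'n^'n)"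
      by (simp flip: mat_eq_scaleR(2))
    moreover have "invertible (mat c :: real^'n^'n)"
      using scalar_inverse(1)[OF c invertible_one] by (simp flip: mat_eq_scaleR(2))
    moreover have "mat (q (m + M)) \<in> K" for m
      using q(1)[of "m + M"] M[of "m + M"] by (intro subsetD[OF HK] scalars F_rational) auto
    ultimately show ?thesis by (rule limit[rotated])
  qed
  \<comment> \<open>Relative closedness descends from the reals: the closure of \<open>H\<close>
    contains GL(n,\<real>) and stays inside \<open>C\<close>, so \<open>C\<close> contains
    GL(n,F).\<close>
  obtain C where C: "closed C" "H = GL_set F \<inter> C" using relclosed by (auto simp: closedin_closed)
  have "closure H \<subseteq> C" using C by (intro closure_minimal) auto
  moreover have "x \<in> K" if "x \<in> GL_set F" for x
  proof (rule contains_GL[OF trans scalarK odd])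
    show "invertible x" using that by (simp add: GL_set_def)
  qed
  ultimately have "GL_set F \<subseteq> C" by (auto simp: K_def)
  then show ?thesis using C(2) by blast
qed simp

text \<open>An arbitrary quotient map \<open>\<pi>\<close> with scalar kernel is allowed, so that an
  iterated quotient of PGL by a trivial subgroup is covered without being identified with
  PGL.\<close>

lemma minimal_of_scalar_kernel:
  fixes \<pi> :: "real^'n^'n \<Rightarrow> 'q" and Q (structure)
  assumes Q: "hausdorff_group Q T"
    and hom: "\<pi> \<in> hom (GL_group F) Q" and surj: "\<pi> ` GL_set F = carrier Q"
    and scalars: "\<And>c. c \<in> F \<Longrightarrow> c \<noteq> 0 \<Longrightarrow> \<pi> (mat c) = \<one>"
    and kernel: "\<And>A. A \<in> GL_set F \<Longrightarrow> \<pi> A = \<one> \<Longrightarrow> \<exists>c. A = mat c"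
    and quot: "\<And>U. openin T U \<longleftrightarrow> U \<subseteq> carrier Q \<and> openin (top_of_set (GL_set F)) {A \<in> GL_set F. \<pi> A \<in> U}"
  shows "minimal_topological_group Q T"
proof -
  interpret Q: hausdorff_group Q T by fact
  interpret \<pi>: group_hom "GL_group F :: (real^'n^'n) monoid" Q \<pi>
    by (intro group_hom.intro group_hom_axioms.intro group_GL hom Q.is_group)
  have mult: "\<pi> (A ** B) = \<pi> A \<otimes> \<pi> B" if "A \<in> GL_set F" "B \<in> GL_set F" for A B
    using \<pi>.hom_mult[of A B] that by (simp add: GL_group_simps)
  have inv: "\<pi> (matrix_inv A) = inv (\<pi> A)" if "A \<in> GL_set F" for A
    using \<pi>.hom_inv[of A] that by (simp add: GL_group_simps inv_GL)
  have one: "\<pi> (mat 1) = \<one>"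
    using \<pi>.hom_one by (simp add: GL_group_simps)
  have mem: "\<pi> A \<in> carrier Q" if "A \<in> GL_set F" for A using surj that by blast
  have scale: "\<pi> (c *\<^sub>R A) = \<pi> A" if "A \<in> GL_set F" "c \<in> F" "c \<noteq> 0" for A c
    using mult[OF mat_GL that(1), of c] scalars[of c] that mem by (simp add: mat_eq_scaleR)
  have eq: "S = T" if S: "hausdorff_topological_group Q S" and coarse: "coarser_topology S T" for S
  proof -
    interpret S: hausdorff_group Q S using S by (simp add: hausdorff_group_iff)
    define \<V> where "\<V> = {{A \<in> GL_set F. \<pi> A \<in> U} |U. openin S U \<and> \<one> \<in> U}"
    interpret scalar_group_nbhds F \<V>
    proof
      have "{A \<in> GL_set F. \<pi> A \<in> topspace S} \<in> \<V>"
        using openin_topspace[of S] unfolding \<V>_def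
        by (intro CollectI exI[of _ "topspace S"]) (simp add: S.topspace)
      then show "\<V> \<noteq> {}" by (rule ex_in_conv[THEN iffD1, OF exI])
      show "V \<subseteq> GL_set F" if "V \<in> \<V>" for V using that by (auto simp: \<V>_def)
      show "\<exists>U\<in>\<V>. U \<subseteq> V \<inter> W" if VW: "V \<in> \<V>" "W \<in> \<V>" for V W
      proof -
        obtain A where A: "openin S A" "\<one> \<in> A" "V = {x \<in> GL_set F. \<pi> x \<in> A}" using VW(1) by (auto simp: \<V>_def)
        obtain B where B: "openin S B" "\<one> \<in> B" "W = {x \<in> GL_set F. \<pi> x \<in> B}" using VW(2) by (auto simp: \<V>_def)
        have "openin S (A \<inter> B)" using A B by blast
        then have "{x \<in> GL_set F. \<pi> x \<in> A \<inter> B} \<in> \<V>" using A B unfolding \<V>_def by blast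
        then show ?thesis using A(3) B(3) by (intro bexI) auto
      qed
      show "\<exists>W\<in>\<V>. \<forall>x\<in>W. \<forall>y\<in>W. x ** matrix_inv y \<in> V" if V: "V \<in> \<V>" for V
      proof -
        obtain A where A: "openin S A" "\<one> \<in> A" "V = {x \<in> GL_set F. \<pi> x \<in> A}" using V by (auto simp: \<V>_def)
        obtain B where B: "openin S B" "\<one> \<in> B" "\<And>x y. x \<in> B \<Longrightarrow> y \<in> B \<Longrightarrow> x \<otimes> inv y \<in> A"
          using S.division_nbhd[OF A(1,2)] by metis
        have "{x \<in> GL_set F. \<pi> x \<in> B} \<in> \<V>" using B(1,2) unfolding \<V>_def by blast
        moreover have "x ** matrix_inv y \<in> V"
          if "x \<in> {x \<in> GL_set F. \<pi> x \<in> B}" "y \<in> {x \<in> GL_set F. \<pi> x \<in> B}" for x y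
          using that B(3) by (simp add: A(3) GL_mult GL_inv mult inv)
        ultimately show ?thesis by blast
      qed
      show "\<exists>W\<in>\<V>. \<forall>x\<in>W. g ** x ** matrix_inv g \<in> V" if V: "V \<in> \<V>" and g: "g \<in> GL_set F" for V g
      proof -
        obtain A where A: "openin S A" "\<one> \<in> A" "V = {x \<in> GL_set F. \<pi> x \<in> A}" using V by (auto simp: \<V>_def)
        let ?B = "{x \<in> carrier Q. \<pi> g \<otimes> x \<otimes> inv (\<pi> g) \<in> A}"
        have "openin S ?B" by (rule S.open_conjugate[OF A(1) mem[OF g]])
        moreover have "\<one> \<in> ?B" using A(2) mem[OF g] by simp
        ultimately have "{x \<in> GL_set F. \<pi> x \<in> ?B} \<in> \<V>" unfolding \<V>_def by blast
        moreover have "g ** x ** matrix_inv g \<in> V" if "x \<in> {x \<in> GL_set F. \<pi> x \<in> ?B}" for x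
          using that g by (simp add: A(3) GL_mult GL_inv mult inv)
        ultimately show ?thesis by blast
      qed
      show "openin (top_of_set (GL_set F)) V" if V: "V \<in> \<V>" for V
      proof -
        obtain A where A: "openin S A" "V = {x \<in> GL_set F. \<pi> x \<in> A}" using V by (auto simp: \<V>_def)
        have "openin T A" using coarse A(1) by (simp add: coarser_topology_def)
        then show ?thesis using quot A(2) by simp
      qed
      show "mat 1 \<in> V" if "V \<in> \<V>" for V using that one one_GL by (auto simp: \<V>_def)
      show "c *\<^sub>R A \<in> V" if "V \<in> \<V>" "A \<in> V" "c \<in> F" "c \<noteq> 0" for V A c
        using that by (auto simp: \<V>_def scale GL_scaleR)
      show "\<exists>c. A = mat c" if A: "A \<in> GL_set F" "\<And>V. V \<in> \<V> \<Longrightarrow> A \<in> V" for A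
      proof (rule kernel[OF A(1)], rule ccontr)
        assume ne: "\<pi> A \<noteq> \<one>"
        then obtain U W where "openin S U" "openin S W" "\<one> \<in> U" "\<pi> A \<in> W" "disjnt U W"
          using S.hausdorff mem[OF A(1)] Q.one_closed unfolding Hausdorff_space_def S.topspace by metis
        moreover from this have "{x \<in> GL_set F. \<pi> x \<in> U} \<in> \<V>" unfolding \<V>_def by blast
        then have "A \<in> {x \<in> GL_set F. \<pi> x \<in> U}" by (rule A(2))
        ultimately show False by (auto simp: disjnt_iff)
      qed
    qed
    have "openin S U" if U: "openin T U" for U
    proof (subst openin_subopen, intro ballI)
      fix x assume "x \<in> U"
      then have x: "x \<in> carrier Q" using Q.open_subset[OF U] by blast
      \<comment> \<open>Right translation moves \<open>U\<close> to a neighbourhood of the identity,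
        where \<open>nbhd_basis\<close> applies; the coarse neighbourhood found there is translated
        back to \<open>x\<close>.\<close>
      let ?U = "{y \<in> carrier Q. y \<otimes> x \<in> U}"
      have "openin T ?U" by (rule Q.open_right_translate[OF U x])
      then have "openin (top_of_set (GL_set F)) {A \<in> GL_set F. \<pi> A \<in> ?U}" using quot by simp
      moreover have "mat 1 \<in> {A \<in> GL_set F. \<pi> A \<in> ?U}" using \<open>x \<in> U\<close> x by (simp add: one_GL one)
      ultimately have "\<exists>V\<in>\<V>. V \<subseteq> {A \<in> GL_set F. \<pi> A \<in> ?U}"
        by (rule nbhd_basis) (auto simp: scale GL_scaleR)
      then obtain W where W: "openin S W" "\<one> \<in> W" "{A \<in> GL_set F. \<pi> A \<in> W} \<subseteq> {A \<in> GL_set F. \<pi> A \<in> ?U}"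
        by (auto simp: \<V>_def)
      have WU: "y \<in> ?U" if y: "y \<in> W" for y
      proof -
        have "y \<in> \<pi> ` GL_set F" using S.open_subset[OF W(1)] y surj by auto
        then obtain A where A: "y = \<pi> A" "A \<in> GL_set F" by (rule imageE)
        then have "A \<in> {A \<in> GL_set F. \<pi> A \<in> ?U}" using y by (intro subsetD[OF W(3)]) simp
        then show ?thesis by (simp add: A(1))
      qed
      let ?W = "{y \<in> carrier Q. y \<otimes> inv x \<in> W}"
      have "openin S ?W" using x by (intro S.open_right_translate[OF W(1)]) simp
      moreover have "x \<in> ?W" using x W(2) by simp
      moreover have "?W \<subseteq> U"
      proof
        fix y assume y: "y \<in> ?W"
        then have "y \<otimes> inv x \<otimes> x \<in> U" using WU by blast
        then show "y \<in> U" using x y by (simp add: Q.m_assoc)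
      qed
      ultimately show "\<exists>W. openin S W \<and> x \<in> W \<and> W \<subseteq> U" by blast
    qed
    then show ?thesis using coarse by (auto simp: topology_eq coarser_topology_def)
  qed
  then show ?thesis
    using Q by (auto simp: minimal_topological_group_def hausdorff_group_iff)
qed

end

section \<open>The quotients of PGL\<close>

lemma minimal_of_trivial:
  assumes "hausdorff_group Q T" "carrier Q = {a}"
  shows "minimal_topological_group Q T"
proof -
  have "S = T" if "topspace S = topspace T" for S
  proof -
    have T: "topspace T = {a}" using hausdorff_group.topspace[OF assms(1)] assms(2) by simp
    have "openin R U \<longleftrightarrow> U = {} \<or> U = {a}" if "topspace R = {a}" for R U
      using openin_subset[of R U] openin_topspace[of R] that by auto
    then show ?thesis using that T by (simp add: topology_eq)
  qed
  then show ?thesis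
    using assms(1) by (auto simp: minimal_topological_group_def hausdorff_group_iff coarser_topology_def)
qed

theorem theorem4p12:
  fixes F :: "real set"
  assumes "subfield F real_ring"
    and "odd CARD('n::finite)"
  shows "totally_minimal_topological_group
           (PGL_group F :: (real^'n^'n) set monoid)
           (PGL_topology F :: (real^'n^'n) set topology)"
proof -
  interpret real_subfield F by (rule real_subfield.intro) fact
  let ?GL = "GL_group F :: (real^'n^'n) monoid"
  let ?Z = "group_center ?GL" and ?PGL = "PGL_group F :: (real^'n^'n) set monoid"
    and ?T = "PGL_topology F :: (real^'n^'n) set topology"
  interpret GL: hausdorff_group ?GL "GL_topology F" by (rule hausdorff_group_GL)
  interpret Z: normal ?Z ?GL by (rule GL.normal_group_center)
  have "hausdorff_group ?PGL ?T"
    unfolding PGL_group_def PGL_topology_def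
    by (intro quotient_hausdorff_group hausdorff_group_GL GL.normal_group_center GL.closed_center)
  then interpret PGL: hausdorff_group ?PGL ?T .
  have "minimal_topological_group (?PGL Mod N) (quotient_group_topology ?PGL ?T N)"
    if N: "N \<lhd> ?PGL" "closedin ?T N" for N
  proof -
    interpret N: normal N ?PGL by (rule N(1))
    have Q: "hausdorff_group (?PGL Mod N) (quotient_group_topology ?PGL ?T N)"
      by (intro quotient_hausdorff_group PGL.hausdorff_group_axioms N)
    define p where "p A = ?Z #>\<^bsub>?GL\<^esub> A" for A
    define \<pi> where "\<pi> A = N #>\<^bsub>?PGL\<^esub> p A" for A
    have p_hom: "p \<in> hom ?GL ?PGL"
      unfolding p_def PGL_group_def by (rule Z.r_coset_hom_Mod)
    have p_surj: "p ` GL_set F = carrier ?PGL"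
      by (simp add: p_def PGL_group_def carrier_FactGroup GL_group_simps)
    have N_hom: "(\<lambda>y. N #>\<^bsub>?PGL\<^esub> y) \<in> hom ?PGL (?PGL Mod N)"
      by (rule N.r_coset_hom_Mod)
    have hom: "\<pi> \<in> hom ?GL (?PGL Mod N)"
      using hom_compose[OF p_hom N_hom] by (simp add: \<pi>_def[abs_def] o_def)
    have surj: "\<pi> ` GL_set F = carrier (?PGL Mod N)"
      using p_surj by (simp add: \<pi>_def[abs_def] carrier_FactGroup flip: image_image)
    interpret p: group_hom ?GL ?PGL p
      by (intro group_hom.intro group_hom_axioms.intro p_hom group_GL PGL.is_group)
    have p_mem: "p A \<in> carrier ?PGL" if "A \<in> GL_set F" for A using p_surj that by blast
    have ker: "\<pi> A = \<one>\<^bsub>?PGL Mod N\<^esub> \<longleftrightarrow> p A \<in> N" if "A \<in> GL_set F" for A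
    proof
      assume "\<pi> A = \<one>\<^bsub>?PGL Mod N\<^esub>"
      then have "N #>\<^bsub>?PGL\<^esub> p A = N" by (simp add: \<pi>_def)
      then show "p A \<in> N" by (rule PGL.coset_join1[OF _ p_mem[OF that] N.is_subgroup])
    next
      assume "p A \<in> N"
      then have "N #>\<^bsub>?PGL\<^esub> p A = N" by (rule PGL.coset_join2[OF p_mem[OF that] N.is_subgroup])
      then show "\<pi> A = \<one>\<^bsub>?PGL Mod N\<^esub>" by (simp add: \<pi>_def)
    qed
    have p_scalar: "p (mat c) = \<one>\<^bsub>?PGL\<^esub>" if "c \<in> F" "c \<noteq> 0" for c
    proof -
      have "?Z #>\<^bsub>?GL\<^esub> mat c = ?Z"
        by (rule GL.coset_join2[OF _ Z.is_subgroup mat_center[OF that]]) (simp add: GL_group_simps mat_GL that)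
      then show ?thesis by (simp add: p_def PGL_group_def)
    qed
    \<comment> \<open>The full preimage of \<open>N\<close> in GL(n,F), which contains all scalars.
      It is also the kernel of \<open>\<pi>\<close>, so the dichotomy for \<open>H\<close> decides
      between a scalar kernel and a trivial quotient.\<close>
    define H where "H = {A \<in> GL_set F. p A \<in> N}"
    have "continuous_map (GL_topology F) ?T p"
      unfolding p_def PGL_topology_def
      by (intro quotient_imp_continuous_map quotient_map_quotient_group_topology GL.topspace)
    from closedin_continuous_map_preimage[OF this N(2)]
    have closedH: "closedin (top_of_set (GL_set F)) H"
      by (simp add: H_def GL.topspace GL_topology_def GL_group_simps)
    have p_mult: "p (A ** B) = p A \<otimes>\<^bsub>?PGL\<^esub> p B" if "A \<in> GL_set F" "B \<in> GL_set F" for A B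
      using p.hom_mult[of A B] that by (simp add: GL_group_simps)
    have p_inv: "p (matrix_inv A) = inv\<^bsub>?PGL\<^esub> (p A)" if "A \<in> GL_set F" for A
      using p.hom_inv[of A] that by (simp add: GL_group_simps inv_GL)
    have "(\<forall>A\<in>H. \<exists>c. A = mat c) \<or> H = GL_set F"
    proof (rule closed_normal_dichotomy[OF assms(2) _ closedH])
      show "H \<subseteq> GL_set F" by (auto simp: H_def)
      show "mat c \<in> H" if "c \<in> F" "c \<noteq> 0" for c
        using that by (simp add: H_def mat_GL p_scalar N.one_closed)
      show "x ** matrix_inv y \<in> H" if "x \<in> H" "y \<in> H" for x y
        using that by (simp add: H_def GL_mult GL_inv p_mult p_inv)
      show "g ** x ** matrix_inv g \<in> H" if "g \<in> GL_set F" "x \<in> H" for g x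
        using that N.inv_op_closed2[OF p_mem[OF that(1)]] by (simp add: H_def GL_mult GL_inv p_mult p_inv)
    qed
    then show ?thesis
    proof
      assume H: "\<forall>A\<in>H. \<exists>c. A = mat c"
      show ?thesis
      proof (rule minimal_of_scalar_kernel[OF Q hom surj])
        show "\<pi> (mat c) = \<one>\<^bsub>?PGL Mod N\<^esub>" if "c \<in> F" "c \<noteq> 0" for c
          using that ker[OF mat_GL[OF that]] by (simp add: p_scalar N.one_closed)
        show "\<exists>c. A = mat c" if "A \<in> GL_set F" "\<pi> A = \<one>\<^bsub>?PGL Mod N\<^esub>" for A
          using that H ker[OF that(1)] by (simp add: H_def)
        show "openin (quotient_group_topology ?PGL ?T N) U \<longleftrightarrow>
            U \<subseteq> carrier (?PGL Mod N) \<and> openin (top_of_set (GL_set F)) {A \<in> GL_set F. \<pi> A \<in> U}" for U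
        proof -
          \<comment> \<open>Both quotient topologies test openness on preimages, so the iterated one
            is the quotient topology of the composite \<open>\<pi>\<close>.\<close>
          have "{A \<in> GL_set F. p A \<in> {x \<in> carrier ?PGL. N #>\<^bsub>?PGL\<^esub> x \<in> U}} = {A \<in> GL_set F. \<pi> A \<in> U}"
            using p_mem by (auto simp: \<pi>_def)
          moreover have "openin ?T W \<longleftrightarrow> W \<subseteq> carrier ?PGL \<and> openin (top_of_set (GL_set F)) {A \<in> GL_set F. p A \<in> W}" for W
            by (simp add: PGL_topology_def PGL_group_def openin_quotient_group_topology GL_topology_def GL_group_simps p_def)
          ultimately show ?thesis
            by (simp add: openin_quotient_group_topology)
        qed
      qed
    next
      assume "H = GL_set F"
      then have "\<pi> A = \<one>\<^bsub>?PGL Mod N\<^esub>" if "A \<in> GL_set F" for A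
        using that ker by (auto simp: H_def)
      then have "carrier (?PGL Mod N) = {\<one>\<^bsub>?PGL Mod N\<^esub>}"
        using surj one_GL by (metis (no_types, lifting) image_cong image_constant)
      then show ?thesis by (rule minimal_of_trivial[OF Q])
    qed
  qed
  then show ?thesis
    using PGL.hausdorff_group_axioms
    by (auto simp: totally_minimal_topological_group_def hausdorff_group_iff)
qed

end
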